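(* Let Assumptions 1, 2 and 3 of the context hold and, additionally, let $F_i$, $i=0,\dots,m$, be convex functions. Let $(x_k)_{k\ge0}$ be generated by the MTA algorithm applied to problem (P) with $x_0\in\mathcal F$, $M_p\ge pL_p$, $M>0$ and $M_q^i\ge qL_q^i$ for all $i=1,\dots,m$ (where $x_{k+1}$ is a minimum point of the convex subproblem). Then, with $D_1,D_2,D$ as in the context, the following sublinear convergence rate holds: $$F(x_k)-F^*\le\frac{2\max\big((p+1)^{p+1},(q+1)^{q+1}\big)\big(D_1(2D)^{p+1}+D_2(2D)^{q+1}\big)}{k^{\min(p,q)}}\qquad\forall k\ge1.$$
   Context: Setting. $\mathbb E$ is a finite-dimensional real vector space with dual $\mathbb E^*$; $B:\mathbb E\to\mathbb E^*$ is self-adjoint positive definite, $\|x\|=\langle Bx,x\rangle^{1/2}$ on $\mathbb E$. $p,q\ge1$ are integers. For a symmetric $p$-linear form, $\|D^p\phi(x)\|=\max\{D^p\phi(x)[d]^p:\|d\|\le1\}$. The Taylor approximation of order $p$ of $\phi$ at $x$ is $T_p^\phi(y;x)=\phi(x)+\sum_{i=1}^p\frac1{i!}D^i\phi(x)[y-x]^i$. Problem (P): minimize $F(x):=F_0(x)+h(x)$ over $x\in\mathbb E$ subject to $F_i(x)\le0$, $i=1,\dots,m$. Feasible set $\mathcal F=\{x\in\mathbb E:F_i(x)\le0,\ i=1,\dots,m\}$. $F^*$ is the optimal value. Assumption 1: $F_0:\mathbb E\to\mathbb R$ is $p$ times continuously differentiable with $\|D^pF_0(x)-D^pF_0(y)\|\le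 L_p\|x-y\|$ for all $x,y$; each $F_i:\mathbb E\to\mathbb R$, $i=1,\dots,m$, is $q$ times continuously differentiable with $\|D^qF_i(x)-D^qF_i(y)\|\le L_q^i\|x-y\|$ for all $x,y$; $h$ is (simple) proper, convex and locally Lipschitz continuous. Assumption 2: $\mathcal F\ne\emptyset$ and, for any fixed $x_0\in\mathcal F$, the set $\mathcal A(x_0)=\{x\in\mathcal F:F(x)\le F(x_0)\}$ is bounded. Assumption 3 (MFCQ): for every $x\in\mathcal F$ there is $d\in\mathbb E$ with $\langle\nabla F_i(x),d\rangle<0$ for all $i\in I(x):=\{i:F_i(x)=0\}$. Models: $s_{M_p}^M(y;x)=T_p^{F_0}(y;x)+\frac{M_p}{(p+1)!}\|y-x\|^{p+1}+\frac{M}{(q+1)!}\|y-x\|^{q+1}$ and $s_{M_q^i}(y;x)=T_q^{F_i}(y;x)+\frac{M_q^i}{(q+1)!}\|y-x\|^{q+1}$; gradients $\nabla s$ are with respect to $y$. MTA algorithm in the convex case: given $x_0\in\mathcal F$, for each $k\ge0$, $x_{k+1}$ is a global minimizer of the subproblem $\min_x s_{M_p}^M(x;x_k)+h(x)$ subject to $s_{M_q^i}(x;x_k)\le0$, $i=1,\dots,m$, which is convex since $M_p\ge pL_p$, $M_q^i\ge qL_q^i$. For each $k\ge 0$, $u^{k+1}=(u_1^{k+1},\dots,u_m^{k+1})\ge0$ denotes Lagrange multipliers for the subproblem at $x_{k+1}$, i.e. for some $\Lambda_{k+1}\in\partial h(x_{k+1})$, $\nabla s_{M_p}^M(x_{k+1};x_k)+\Lambda_{k+1}+\sum_iu_i^{k+1}\nabla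 s_{M_q^i}(x_{k+1};x_k)=0$ and $u_i^{k+1}s_{M_q^i}(x_{k+1};x_k)=0$ for all $i$; such multipliers exist and are bounded, and $C_u>0$ is a constant with $\|u^k\|\le C_u$ for all $k\ge1$. The sequence $(x_k)_{k\ge0}$ is bounded, and $D>0$ is a constant with $\|x_k\|\le D$ for all $k\ge0$. Constants: $D_1=\frac{M_p+L_p}{(p+1)!}$ and $D_2=\frac{M+\sum_{i=1}^mC_u(M_q^i+L_q^i)}{(q+1)!}$. *)

theory Defs
  imports "HOL-Analysis.Analysis"
begin

text \<open>
  The space is a type \<open>'a::euclidean_space\<close>; its dual is \<open>'a \<Rightarrow>\<^sub>L real\<close>. The inner product of
  the type class plays no role: all norms are taken with respect to an arbitrary operator
  \<open>B :: 'a \<Rightarrow> 'a \<Rightarrow>\<^sub>L real\<close>, and gradients and subgradients live in the dual.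
\<close>

definition self_adjoint_pos_def :: "('a::euclidean_space \<Rightarrow> 'a \<Rightarrow>\<^sub>L real) \<Rightarrow> bool" where
  "self_adjoint_pos_def B \<longleftrightarrow>
     linear B \<and>
     (\<forall>x y. blinfun_apply (B x) y = blinfun_apply (B y) x) \<and>
     (\<forall>x. x \<noteq> 0 \<longrightarrow> 0 < blinfun_apply (B x) x)"

definition Bnorm :: "('a::euclidean_space \<Rightarrow> 'a \<Rightarrow>\<^sub>L real) \<Rightarrow> 'a \<Rightarrow> real" where
  "Bnorm B x = sqrt (blinfun_apply (B x) x)"

definition grad :: "('a::euclidean_space \<Rightarrow> real) \<Rightarrow> 'a \<Rightarrow> 'a \<Rightarrow>\<^sub>L real" where
  "grad f x = Blinfun (frechet_derivative f (at x))"


text \<open>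
  \<open>iter_deriv f [d1, \<dots>, dn] x\<close> is the value \<open>D\<^sup>nf(x)[d1, \<dots>, dn]\<close> of the \<open>n\<close>-th derivative,
  obtained by differentiating successively along the fixed directions \<open>dn, \<dots>, d1\<close>.
\<close>

primrec iter_deriv :: "('a::euclidean_space \<Rightarrow> real) \<Rightarrow> 'a list \<Rightarrow> 'a \<Rightarrow> real" where
  "iter_deriv f [] = f"
| "iter_deriv f (d # ds) = (\<lambda>x. frechet_derivative (iter_deriv f ds) (at x) d)"

text \<open>
  In finite dimension, differentiability and continuity of a derivative as a map into the
  multilinear forms amount to those of its values at fixed directions.
\<close>

definition times_cont_diff :: "nat \<Rightarrow> ('a::euclidean_space \<Rightarrow> real) \<Rightarrow> bool" where
  "times_cont_diff n f \<longleftrightarrow>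
     (\<forall>ds. length ds < n \<longrightarrow> (\<forall>x. iter_deriv f ds differentiable (at x))) \<and>
     (\<forall>ds. length ds \<le> n \<longrightarrow> continuous_on UNIV (iter_deriv f ds))"

text \<open>
  Norm of a symmetric \<open>n\<close>-linear form \<open>A\<close>, given as a function of the list of its \<open>n\<close> arguments.
  The supremum is attained, as the unit ball is compact.
\<close>

definition form_norm ::
  "('a::euclidean_space \<Rightarrow> 'a \<Rightarrow>\<^sub>L real) \<Rightarrow> nat \<Rightarrow> ('a list \<Rightarrow> real) \<Rightarrow> real" where
  "form_norm B n A = (SUP d\<in>{d. Bnorm B d \<le> 1}. A (replicate n d))"

definition lipschitz_deriv ::
  "('a::euclidean_space \<Rightarrow> 'a \<Rightarrow>\<^sub>L real) \<Rightarrow> nat \<Rightarrow> real \<Rightarrow> ('a \<Rightarrow> real) \<Rightarrow> bool" where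
  "lipschitz_deriv B n L f \<longleftrightarrow>
     (\<forall>x y. form_norm B n (\<lambda>ds. iter_deriv f ds x - iter_deriv f ds y) \<le> L * Bnorm B (x - y))"

definition taylor :: "nat \<Rightarrow> ('a::euclidean_space \<Rightarrow> real) \<Rightarrow> 'a \<Rightarrow> 'a \<Rightarrow> real" where
  "taylor n f y x = f x + (\<Sum>i=1..n. 1 / fact i * iter_deriv f (replicate i (y - x)) x)"


text \<open>
  The function \<open>h\<close> is extended-valued. Local Lipschitz continuity is required on its effective
  domain; if \<open>h\<close> is finite everywhere, this is local Lipschitz continuity on the whole space.
\<close>

definition edom :: "('a::euclidean_space \<Rightarrow> ereal) \<Rightarrow> 'a set" where
  "edom h = {x. h x < \<infinity>}"

definition proper_fun :: "('a::euclidean_space \<Rightarrow> ereal) \<Rightarrow> bool" where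
  "proper_fun h \<longleftrightarrow> (\<forall>x. h x \<noteq> -\<infinity>) \<and> edom h \<noteq> {}"

definition convex_fun :: "('a::euclidean_space \<Rightarrow> ereal) \<Rightarrow> bool" where
  "convex_fun h \<longleftrightarrow>
     (\<forall>x y. \<forall>t\<in>{0<..<1}. h ((1 - t) *\<^sub>R x + t *\<^sub>R y) \<le> ereal (1 - t) * h x + ereal t * h y)"

definition locally_lipschitz_fun ::
  "('a::euclidean_space \<Rightarrow> 'a \<Rightarrow>\<^sub>L real) \<Rightarrow> ('a \<Rightarrow> ereal) \<Rightarrow> bool" where
  "locally_lipschitz_fun B h \<longleftrightarrow>
     (\<forall>x\<in>edom h. \<exists>e>0. \<exists>L. \<forall>y\<in>edom h. \<forall>z\<in>edom h.
        Bnorm B (y - x) < e \<longrightarrow> Bnorm B (z - x) < e \<longrightarrow>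
        \<bar>real_of_ereal (h y) - real_of_ereal (h z)\<bar> \<le> L * Bnorm B (y - z))"

definition subdiff :: "('a::euclidean_space \<Rightarrow> ereal) \<Rightarrow> 'a \<Rightarrow> ('a \<Rightarrow>\<^sub>L real) set" where
  "subdiff h x = {g. x \<in> edom h \<and> (\<forall>y. h x + ereal (blinfun_apply g (y - x)) \<le> h y)}"


text \<open>
  Problem data: \<open>F 0\<close> is the smooth part of the objective and \<open>F 1, \<dots>, F m\<close> are the constraints.
\<close>

definition feasible :: "nat \<Rightarrow> (nat \<Rightarrow> 'a::euclidean_space \<Rightarrow> real) \<Rightarrow> 'a set" where
  "feasible m F = {x. \<forall>i\<in>{1..m}. F i x \<le> 0}"

definition objective ::
  "(nat \<Rightarrow> 'a::euclidean_space \<Rightarrow> real) \<Rightarrow> ('a \<Rightarrow> ereal) \<Rightarrow> 'a \<Rightarrow> ereal" where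
  "objective F h x = ereal (F 0 x) + h x"

definition optimal_value ::
  "nat \<Rightarrow> (nat \<Rightarrow> 'a::euclidean_space \<Rightarrow> real) \<Rightarrow> ('a \<Rightarrow> ereal) \<Rightarrow> ereal" where
  "optimal_value m F h = (INF x\<in>feasible m F. objective F h x)"

definition mfcq :: "nat \<Rightarrow> (nat \<Rightarrow> 'a::euclidean_space \<Rightarrow> real) \<Rightarrow> bool" where
  "mfcq m F \<longleftrightarrow>
     (\<forall>x\<in>feasible m F. \<exists>d. \<forall>i\<in>{1..m}. F i x = 0 \<longrightarrow> blinfun_apply (grad (F i) x) d < 0)"

definition model_obj ::
  "('a::euclidean_space \<Rightarrow> 'a \<Rightarrow>\<^sub>L real) \<Rightarrow> nat \<Rightarrow> nat \<Rightarrow> real \<Rightarrow> real \<Rightarrow> ('a \<Rightarrow> real)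
     \<Rightarrow> 'a \<Rightarrow> 'a \<Rightarrow> real" where
  "model_obj B p q Mp M f y x =
     taylor p f y x + Mp / fact (p + 1) * Bnorm B (y - x) ^ (p + 1)
       + M / fact (q + 1) * Bnorm B (y - x) ^ (q + 1)"

definition model_con ::
  "('a::euclidean_space \<Rightarrow> 'a \<Rightarrow>\<^sub>L real) \<Rightarrow> nat \<Rightarrow> real \<Rightarrow> ('a \<Rightarrow> real) \<Rightarrow> 'a \<Rightarrow> 'a \<Rightarrow> real" where
  "model_con B q Mq f y x = taylor q f y x + Mq / fact (q + 1) * Bnorm B (y - x) ^ (q + 1)"

definition mta_step ::
  "('a::euclidean_space \<Rightarrow> 'a \<Rightarrow>\<^sub>L real) \<Rightarrow> nat \<Rightarrow> nat \<Rightarrow> nat \<Rightarrow> real \<Rightarrow> real \<Rightarrow> (nat \<Rightarrow> real)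
     \<Rightarrow> (nat \<Rightarrow> 'a \<Rightarrow> real) \<Rightarrow> ('a \<Rightarrow> ereal) \<Rightarrow> 'a \<Rightarrow> 'a \<Rightarrow> bool" where
  "mta_step B m p q Mp M Mq F h x x' \<longleftrightarrow>
     is_arg_min (\<lambda>y. ereal (model_obj B p q Mp M (F 0) y x) + h y)
       (\<lambda>y. \<forall>i\<in>{1..m}. model_con B q (Mq i) (F i) y x \<le> 0) x'"

definition subproblem_multipliers ::
  "('a::euclidean_space \<Rightarrow> 'a \<Rightarrow>\<^sub>L real) \<Rightarrow> nat \<Rightarrow> nat \<Rightarrow> nat \<Rightarrow> real \<Rightarrow> real \<Rightarrow> (nat \<Rightarrow> real)
     \<Rightarrow> (nat \<Rightarrow> 'a \<Rightarrow> real) \<Rightarrow> ('a \<Rightarrow> ereal) \<Rightarrow> 'a \<Rightarrow> 'a \<Rightarrow> (nat \<Rightarrow> real) \<Rightarrow> bool" where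
  "subproblem_multipliers B m p q Mp M Mq F h x x' u \<longleftrightarrow>
     (\<forall>i\<in>{1..m}. 0 \<le> u i) \<and>
     (\<exists>\<Lambda>\<in>subdiff h x'.
        grad (\<lambda>y. model_obj B p q Mp M (F 0) y x) x' + \<Lambda>
          + (\<Sum>i=1..m. u i *\<^sub>R grad (\<lambda>y. model_con B q (Mq i) (F i) y x) x') = 0) \<and>
     (\<forall>i\<in>{1..m}. u i * model_con B q (Mq i) (F i) x' x = 0)"

end

theory Submission
  imports Defs
begin

text \<open>
  The models are convex: along a line, the second derivative of the Taylor polynomial of \<open>f\<close> is
  the Taylor polynomial of \<open>D\<^sup>2f[v, v] \<ge> 0\<close>, and its error is dominated by the second derivative
  of the norm power once \<open>M \<ge> n L\<close>. The error involves \<open>D\<^sup>nf[d, \<dots>, d, v, v]\<close>, whereas the Lipschitz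
  hypothesis only controls the diagonal; Banach's theorem on symmetric forms bridges the gap without
  loss in the constant.

  Hence \<open>x\<^sub>k\<^sub>+\<^sub>1\<close> minimises the Lagrangian of the subproblem globally, which yields
  \<open>F(x\<^sub>k\<^sub>+\<^sub>1) \<le> F(z) + D\<^sub>1 \<parallel>z - x\<^sub>k\<parallel>\<^sup>p\<^sup>+\<^sup>1 + D\<^sub>2 \<parallel>z - x\<^sub>k\<parallel>\<^sup>q\<^sup>+\<^sup>1\<close> for all feasible \<open>z\<close>. With
  \<open>z = (1 - \<alpha>) x\<^sub>k + \<alpha> y\<close>, \<open>\<alpha> = (r + 1) / (k + r + 1)\<close> and \<open>r = min p q\<close>, this is a recursion for
  \<open>F(x\<^sub>k) - F(y)\<close>. Its first step has \<open>\<alpha> = 1\<close>, so \<open>h(x\<^sub>0) = \<infinity>\<close> does no harm.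
\<close>

subsection \<open>Symmetric multilinear forms and the energy norm\<close>

locale energy_norm =
  fixes B :: "'a::euclidean_space \<Rightarrow> 'a \<Rightarrow>\<^sub>L real"
  assumes B: "self_adjoint_pos_def B"
begin

lemma linear_B: "linear B"
  and B_commute: "B x y = B y x"
  and B_pos: "x \<noteq> 0 \<Longrightarrow> 0 < B x x"
  using B by (auto simp: self_adjoint_pos_def_def)

lemma bounded_bilinear_B: "bounded_bilinear (\<lambda>x y. B x y)"
  using bounded_bilinear.comp1[OF bounded_bilinear_blinfun_apply, of B] linear_B
  by (simp add: linear_conv_bounded_linear)

lemmas B_simps =
  bounded_bilinear.add_left[OF bounded_bilinear_B] bounded_bilinear.add_right[OF bounded_bilinear_B]
  bounded_bilinear.diff_left[OF bounded_bilinear_B] bounded_bilinear.diff_right[OF bounded_bilinear_B]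
  bounded_bilinear.minus_left[OF bounded_bilinear_B] bounded_bilinear.minus_right[OF bounded_bilinear_B]
  bounded_bilinear.scaleR_left[OF bounded_bilinear_B] bounded_bilinear.scaleR_right[OF bounded_bilinear_B]
  bounded_bilinear.zero_left[OF bounded_bilinear_B] bounded_bilinear.zero_right[OF bounded_bilinear_B]

lemma B_nonneg: "0 \<le> B x x"
  using B_pos[of x] by (cases "x = 0") (auto simp: B_simps)

lemma Bnorm_sq: "(Bnorm B x)\<^sup>2 = B x x"
  by (simp add: Bnorm_def B_nonneg)

lemma Bnorm_nonneg [simp]: "0 \<le> Bnorm B x"
  by (simp add: Bnorm_def B_nonneg)

lemma Bnorm_eq_0_iff [simp]: "Bnorm B x = 0 \<longleftrightarrow> x = 0"
  using B_pos[of x] by (cases "x = 0") (auto simp: Bnorm_def B_simps)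

lemma Bnorm_0 [simp]: "Bnorm B 0 = 0"
  by simp

lemma Bnorm_pos: "x \<noteq> 0 \<Longrightarrow> 0 < Bnorm B x"
  by (simp add: less_le)

lemma Bnorm_scaleR: "Bnorm B (c *\<^sub>R x) = \<bar>c\<bar> * Bnorm B x"
  by (simp add: Bnorm_def B_simps real_sqrt_mult mult.assoc[symmetric])

lemma Bnorm_minus: "Bnorm B (- x) = Bnorm B x"
  by (simp add: Bnorm_def B_simps)

lemma Bnorm_minus_commute: "Bnorm B (x - y) = Bnorm B (y - x)"
  using Bnorm_minus[of "x - y"] by simp

lemma Bnorm_parallelogram:
  "(Bnorm B (x + y))\<^sup>2 + (Bnorm B (x - y))\<^sup>2 = 2 * (Bnorm B x)\<^sup>2 + 2 * (Bnorm B y)\<^sup>2"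
  by (simp add: Bnorm_sq B_simps)

text \<open>Discarding the square of \<open>Bnorm B (x + y)\<close> in the parallelogram identity
  already gives the constant 2, so neither the Cauchy-Schwarz nor the triangle inequality is
  required.\<close>

lemma Bnorm_diff_le:
  assumes "Bnorm B x \<le> r" "Bnorm B y \<le> r"
  shows "Bnorm B (x - y) \<le> 2 * r"
proof -
  have "0 \<le> r" using assms(1) Bnorm_nonneg[of x] by linarith
  have "(Bnorm B (x - y))\<^sup>2 \<le> 2 * (Bnorm B x)\<^sup>2 + 2 * (Bnorm B y)\<^sup>2"
    using Bnorm_parallelogram[of x y] zero_le_power2[of "Bnorm B (x + y)"] by linarith
  also have "\<dots> \<le> 2 * r\<^sup>2 + 2 * r\<^sup>2"
    using assms by (intro add_mono mult_left_mono power_mono) auto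
  also have "\<dots> = (2 * r)\<^sup>2" by (simp add: power2_eq_square)
  finally show ?thesis using \<open>0 \<le> r\<close> power2_le_imp_le[of "Bnorm B (x - y)" "2 * r"] by simp
qed

lemma continuous_on_Bnorm: "continuous_on S (Bnorm B)"
  unfolding Bnorm_def
  by (intro continuous_intros bounded_bilinear.continuous_on[OF bounded_bilinear_B])

lemma isCont_Bnorm: "isCont (Bnorm B) x"
  using continuous_on_Bnorm[of UNIV] by (simp add: continuous_on_eq_continuous_at)

text \<open>On the Euclidean unit sphere \<open>Bnorm B\<close> attains a positive minimum by
  compactness; homogeneity does the rest. The estimate makes energy balls and spheres
  bounded.\<close>

lemma norm_le_Bnorm: "\<exists>c>0. \<forall>x. norm x \<le> c * Bnorm B x"
proof -
  obtain z where z: "z \<in> sphere 0 1" "\<And>y. y \<in> sphere 0 1 \<Longrightarrow> Bnorm B z \<le> Bnorm B y"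
    using continuous_attains_inf[OF compact_sphere, of 0 1 "Bnorm B"] continuous_on_Bnorm
    by (auto simp: sphere_eq_empty)
  have "0 < Bnorm B z" using z(1) by (intro Bnorm_pos) auto
  moreover have "norm x \<le> 1 / Bnorm B z * Bnorm B x" for x
  proof (cases "x = 0")
    case False
    then have "Bnorm B z \<le> Bnorm B ((1 / norm x) *\<^sub>R x)" by (intro z(2)) auto
    then show ?thesis using False \<open>0 < Bnorm B z\<close> by (simp add: Bnorm_scaleR field_simps)
  qed simp
  ultimately show ?thesis by (intro exI[of _ "1 / Bnorm B z"]) simp
qed

text \<open>A general \<open>T\<close> covers both the unit sphere, \<open>T = {1}\<close>, and the
  unit ball, \<open>T = {0..1}\<close>.\<close>

lemma compact_Bnorm:
  assumes "closed T" "bounded T"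
  shows "compact {x. Bnorm B x \<in> T}"
proof -
  obtain c where c: "c > 0" "\<And>x. norm x \<le> c * Bnorm B x" using norm_le_Bnorm by blast
  obtain b where b: "\<And>t. t \<in> T \<Longrightarrow> \<bar>t\<bar> \<le> b"
    using assms(2) by (auto simp: bounded_iff)
  have "norm x \<le> c * b" if "Bnorm B x \<in> T" for x
    using c(2)[of x] b[OF that] c(1) by (smt (verit) mult_left_mono)
  then have "bounded {x. Bnorm B x \<in> T}" unfolding bounded_iff by blast
  moreover have "closed {x. Bnorm B x \<in> T}"
    using continuous_on_Bnorm[of UNIV] assms(1) continuous_on_closed_vimage[of UNIV "Bnorm B"]
    by (auto simp: vimage_def)
  ultimately show ?thesis by (simp add: compact_eq_bounded_closed)
qed

text \<open>At \<open>x = 0\<close> any unit vector serves, so later normalisations need no case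
  distinction.\<close>

lemma unit_multiple: obtains e where "Bnorm B e = 1" "x = Bnorm B x *\<^sub>R e"
proof -
  obtain b :: 'a where b: "b \<in> Basis" using nonempty_Basis by blast
  define y where "y = (if x = 0 then b else x)"
  have "y \<noteq> 0" using b by (auto simp: y_def)
  then show ?thesis
    by (intro that[of "(1 / Bnorm B y) *\<^sub>R y"]) (auto simp: Bnorm_scaleR y_def split: if_splits)
qed

end

text \<open>Linearity in the first argument suffices, because symmetry, expressed by equality of
  multisets, moves any other argument to the front.\<close>

definition sym_multilinear :: "nat \<Rightarrow> ('a::euclidean_space list \<Rightarrow> real) \<Rightarrow> bool" where
  "sym_multilinear n A \<longleftrightarrow>
     (\<forall>ds. Suc (length ds) = n \<longrightarrow> linear (\<lambda>d. A (d # ds))) \<and>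
     (\<forall>ds es. length ds = n \<longrightarrow> mset ds = mset es \<longrightarrow> A ds = A es)"

lemma sym_multilinear_linear: "sym_multilinear n A \<Longrightarrow> Suc (length ds) = n \<Longrightarrow> linear (\<lambda>d. A (d # ds))"
  by (simp add: sym_multilinear_def)

lemma sym_multilinear_mset:
  "sym_multilinear n A \<Longrightarrow> length ds = n \<Longrightarrow> mset ds = mset es \<Longrightarrow> A ds = A es"
  unfolding sym_multilinear_def by blast

lemma sym_multilinear_expand:
  assumes "sym_multilinear n A" "Suc (length ds) = n"
  shows "A (y # ds) = (\<Sum>b\<in>Basis. (y \<bullet> b) * A (b # ds))"
proof -
  have l: "linear (\<lambda>d. A (d # ds))" using sym_multilinear_linear[OF assms] .
  have "A (y # ds) = A ((\<Sum>b\<in>Basis. (y \<bullet> b) *\<^sub>R b) # ds)" by (simp add: euclidean_representation)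
  also have "\<dots> = (\<Sum>b\<in>Basis. (y \<bullet> b) * A (b # ds))"
    using linear_sum[OF l, of "\<lambda>b. (y \<bullet> b) *\<^sub>R b" Basis] linear_scale[OF l] by simp
  finally show ?thesis .
qed

text \<open>One copy of \<open>y\<close> is expanded in the basis and the product rule is applied.
  The list \<open>vs\<close> of frozen arguments makes the induction go through, since each
  expansion freezes a basis vector.\<close>

lemma sym_multilinear_diag_has_derivative:
  assumes "sym_multilinear N A" "length vs + n = N"
  shows "((\<lambda>y. A (replicate n y @ vs)) has_derivative
           (\<lambda>w. real n * A (replicate (n - 1) y @ w # vs))) (at y within S)"
  using assms(2)
proof (induction n arbitrary: vs)
  case 0
  then show ?case by simp
next
  case (Suc n)
  have ex: "A (replicate (Suc n) z @ vs) = (\<Sum>b\<in>Basis. (z \<bullet> b) * A (replicate n z @ b # vs))" for z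
  proof -
    have "A (replicate (Suc n) z @ vs) = (\<Sum>b\<in>Basis. (z \<bullet> b) * A (b # replicate n z @ vs))"
      using sym_multilinear_expand[OF assms(1), of "replicate n z @ vs" z] Suc.prems by simp
    also have "\<dots> = (\<Sum>b\<in>Basis. (z \<bullet> b) * A (replicate n z @ b # vs))"
      using Suc.prems by (intro sum.cong refl arg_cong2[of _ _ _ _ "(*)"] sym_multilinear_mset[OF assms(1)]) auto
    finally show ?thesis .
  qed
  have der: "((\<lambda>z. \<Sum>b\<in>Basis. (z \<bullet> b) * A (replicate n z @ b # vs)) has_derivative
     (\<lambda>w. \<Sum>b\<in>Basis. (y \<bullet> b) * (real n * A (replicate (n - 1) y @ w # b # vs))
            + (w \<bullet> b) * A (replicate n y @ b # vs))) (at y within S)"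
    using Suc.prems by (intro has_derivative_sum has_derivative_mult Suc.IH has_derivative_inner_left
      has_derivative_ident) auto
  have "(\<Sum>b\<in>Basis. (y \<bullet> b) * (real n * A (replicate (n - 1) y @ w # b # vs))
            + (w \<bullet> b) * A (replicate n y @ b # vs)) = real (Suc n) * A (replicate n y @ w # vs)" for w
  proof -
    have "(\<Sum>b\<in>Basis. (w \<bullet> b) * A (replicate n y @ b # vs)) = (\<Sum>b\<in>Basis. (w \<bullet> b) * A (b # replicate n y @ vs))"
      using Suc.prems by (intro sum.cong refl arg_cong2[of _ _ _ _ "(*)"] sym_multilinear_mset[OF assms(1)]) auto
    also have "\<dots> = A (w # replicate n y @ vs)"
      using sym_multilinear_expand[OF assms(1), of "replicate n y @ vs" w] Suc.prems by simp
    also have "\<dots> = A (replicate n y @ w # vs)"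
      using Suc.prems by (intro sym_multilinear_mset[OF assms(1)]) auto
    finally have 1: "(\<Sum>b\<in>Basis. (w \<bullet> b) * A (replicate n y @ b # vs)) = A (replicate n y @ w # vs)" .
    \<comment> \<open>For \<open>n = 0\<close> the factor \<open>real n\<close> removes the term
      with the truncated \<open>n - 1\<close>; otherwise the basis sum reassembles into one more
      copy of \<open>y\<close>.\<close>
    have 2: "(\<Sum>b\<in>Basis. (y \<bullet> b) * (real n * A (replicate (n - 1) y @ w # b # vs)))
       = real n * A (replicate n y @ w # vs)"
    proof (cases n)
      case (Suc l)
      have "(\<Sum>b\<in>Basis. (y \<bullet> b) * (real n * A (replicate (n - 1) y @ w # b # vs)))
        = real n * (\<Sum>b\<in>Basis. (y \<bullet> b) * A (replicate (n - 1) y @ w # b # vs))"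
        by (simp add: sum_distrib_left mult_ac)
      also have "(\<Sum>b\<in>Basis. (y \<bullet> b) * A (replicate (n - 1) y @ w # b # vs))
        = (\<Sum>b\<in>Basis. (y \<bullet> b) * A (b # replicate l y @ w # vs))"
        using Suc.prems Suc by (intro sum.cong refl arg_cong2[of _ _ _ _ "(*)"] sym_multilinear_mset[OF assms(1)]) auto
      also have "\<dots> = A (y # replicate l y @ w # vs)"
        using sym_multilinear_expand[OF assms(1), of "replicate l y @ w # vs" y] Suc.prems Suc by simp
      also have "y # replicate l y @ w # vs = replicate n y @ w # vs" using Suc by simp
      finally show ?thesis .
    qed simp
    show ?thesis unfolding sum.distrib 1 2 by (simp add: algebra_simps)
  qed
  then show ?case using der by (simp add: ex[abs_def] del: replicate_Suc)
qed

lemma sym_multilinear_scale: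
  assumes "sym_multilinear N A" "length vs + n = N"
  shows "A (map (\<lambda>i. c i *\<^sub>R f i) [0..<n] @ vs) = (\<Prod>i<n. c i) * A (map f [0..<n] @ vs)"
  using assms(2)
proof (induction n arbitrary: vs)
  case (Suc n)
  have "A (map (\<lambda>i. c i *\<^sub>R f i) [0..<Suc n] @ vs) = A (map (\<lambda>i. c i *\<^sub>R f i) [0..<n] @ (c n *\<^sub>R f n) # vs)"
    by simp
  also have "\<dots> = (\<Prod>i<n. c i) * A (map f [0..<n] @ (c n *\<^sub>R f n) # vs)"
    using Suc.prems by (intro Suc.IH) simp
  also have "A (map f [0..<n] @ (c n *\<^sub>R f n) # vs) = A ((c n *\<^sub>R f n) # map f [0..<n] @ vs)"
    using Suc.prems by (intro sym_multilinear_mset[OF assms(1)]) auto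
  also have "\<dots> = c n * A (f n # map f [0..<n] @ vs)"
    using linear_scale[OF sym_multilinear_linear[OF assms(1), of "map f [0..<n] @ vs"]] Suc.prems by simp
  also have "A (f n # map f [0..<n] @ vs) = A (map f [0..<n] @ f n # vs)"
    using Suc.prems by (intro sym_multilinear_mset[OF assms(1)]) auto
  finally show ?case by simp
qed simp

lemma sym_multilinear_scale_replicate:
  assumes "sym_multilinear N A" "length vs + n = N"
  shows "A (replicate n (c *\<^sub>R d) @ vs) = c ^ n * A (replicate n d @ vs)"
  using sym_multilinear_scale[OF assms, of "\<lambda>_. c" "\<lambda>_. d"] by (simp add: map_replicate_const)

text \<open>Tuples are read off functions on the naturals, so that joint continuity can be stated in
  the product topology, where Tychonoff's theorem gives compact sets of tuples.\<close>

lemma sym_multilinear_continuous_on: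
  assumes "sym_multilinear N A" "length vs + n = N"
  shows "continuous_on S (\<lambda>f. A (map f [0..<n] @ vs))"
  using assms(2)
proof (induction n arbitrary: vs)
  case (Suc n)
  have "A (map f [0..<Suc n] @ vs) = (\<Sum>b\<in>Basis. (f n \<bullet> b) * A (map f [0..<n] @ b # vs))" for f
  proof -
    have "A (map f [0..<Suc n] @ vs) = A (f n # map f [0..<n] @ vs)"
      using Suc.prems by (intro sym_multilinear_mset[OF assms(1)]) auto
    also have "\<dots> = (\<Sum>b\<in>Basis. (f n \<bullet> b) * A (b # map f [0..<n] @ vs))"
      using sym_multilinear_expand[OF assms(1), of "map f [0..<n] @ vs" "f n"] Suc.prems by simp
    also have "\<dots> = (\<Sum>b\<in>Basis. (f n \<bullet> b) * A (map f [0..<n] @ b # vs))"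
      using Suc.prems by (intro sum.cong refl arg_cong2[of _ _ _ _ "(*)"] sym_multilinear_mset[OF assms(1)]) auto
    finally show ?thesis .
  qed
  moreover have "continuous_on S (\<lambda>f. \<Sum>b\<in>Basis. (f n \<bullet> b) * A (map f [0..<n] @ b # vs))"
  proof -
    have "continuous_on S (\<lambda>f. f n)"
      using continuous_on_product_then_coordinatewise[OF continuous_on_id] .
    then show ?thesis using Suc.prems
      by (intro continuous_on_sum continuous_on_mult[where f="\<lambda>f. f n \<bullet> _"] continuous_on_inner continuous_on_const Suc.IH) auto
  qed
  ultimately show ?case by simp
qed (simp add: continuous_on_const)

lemma compact_Pi_UNIV:
  fixes S :: "'b \<Rightarrow> 'a::topological_space set"
  assumes "\<And>i. compact (S i)"
  shows "compact {f. \<forall>i. f i \<in> S i}"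
proof -
  have "compactin (product_topology (\<lambda>i. euclidean) UNIV) (PiE UNIV S)"
    using assms by (simp add: compactin_PiE)
  then show ?thesis by (simp add: euclidean_product_topology PiE_def Pi_def)
qed

lemma sym_multilinear_diff:
  assumes "sym_multilinear n A" "sym_multilinear n A'"
  shows "sym_multilinear n (\<lambda>ds. A ds - A' ds)"
  unfolding sym_multilinear_def
proof (intro conjI allI impI)
  fix ds :: "'a list" assume "Suc (length ds) = n"
  then show "linear (\<lambda>d. A (d # ds) - A' (d # ds))"
    by (intro linear_compose_sub sym_multilinear_linear[OF assms(1)] sym_multilinear_linear[OF assms(2)])
next
  fix ds es :: "'a list" assume "length ds = n" "mset ds = mset es"
  then show "A ds - A' ds = A es - A' es"
    using sym_multilinear_mset[OF assms(1), of ds es] sym_multilinear_mset[OF assms(2), of ds es] by simp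
qed

section \<open>Banach's theorem on symmetric forms\<close>

context energy_norm begin

text \<open>Polarization writes \<open>4 * A (x # y # ds)\<close> as a difference of two diagonal
  values, while the squared norms of \<open>x + y\<close> and \<open>x - y\<close> add up to 4. A
  maximal value at \<open>(x, y)\<close> therefore makes both diagonal bounds tight.\<close>

lemma sym_multilinear_polarized_max:
  assumes A: "sym_multilinear N A" "length ds + 2 = N"
    and bd: "\<And>z. \<bar>A (z # z # ds)\<bar> \<le> w * (Bnorm B z)\<^sup>2"
    and unit: "Bnorm B x = 1" "Bnorm B y = 1" and max: "\<bar>A (x # y # ds)\<bar> = w"
  shows "\<bar>A ((x + y) # (x + y) # ds)\<bar> = w * (Bnorm B (x + y))\<^sup>2"
proof -
  have lin: "A ((a + b) # c # ds) = A (a # c # ds) + A (b # c # ds)"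
            "A ((a - b) # c # ds) = A (a # c # ds) - A (b # c # ds)" for a b c
    using linear_add[OF sym_multilinear_linear[OF A(1), of "c # ds"]]
      linear_diff[OF sym_multilinear_linear[OF A(1), of "c # ds"]] A(2) by auto
  have sw: "A (a # b # ds) = A (b # a # ds)" for a b
    using A by (intro sym_multilinear_mset[OF A(1)]) auto
  have "A (x # (x + y) # ds) = A (x # x # ds) + A (x # y # ds)"
       "A (y # (x + y) # ds) = A (y # y # ds) + A (x # y # ds)"
       "A (x # (x - y) # ds) = A (x # x # ds) - A (x # y # ds)"
       "A (y # (x - y) # ds) = A (x # y # ds) - A (y # y # ds)"
    by (simp_all add: sw[of x "x + y"] sw[of y "x + y"] sw[of x "x - y"] sw[of y "x - y"] lin sw[of y x])
  then have pol: "A ((x + y) # (x + y) # ds) - A ((x - y) # (x - y) # ds) = 4 * A (x # y # ds)"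
    by (simp add: lin)
  have par: "(Bnorm B (x + y))\<^sup>2 + (Bnorm B (x - y))\<^sup>2 = 4"
    using Bnorm_parallelogram[of x y] unit by simp
  have "4 * w \<le> \<bar>A ((x + y) # (x + y) # ds)\<bar> + w * (Bnorm B (x - y))\<^sup>2"
    using pol max bd[of "x - y"] by linarith
  moreover have "w * (Bnorm B (x + y))\<^sup>2 + w * (Bnorm B (x - y))\<^sup>2 = 4 * w"
    using par by (metis distrib_left mult.commute)
  ultimately show ?thesis using bd[of "x + y"] by linarith
qed

text \<open>Among the unit tuples maximising \<open>\<bar>A\<bar>\<close>, take one with the largest \<open>\<Sum>\<^sub>i B(x\<^sub>i, e)\<close>. By polarization,
  two distinct entries could both be replaced by their normalised sum, which increases this potential;
  so all entries coincide.\<close>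
theorem sym_multilinear_bound_units:
  assumes A: "sym_multilinear N A"
    and diag: "\<And>d. Bnorm B d = 1 \<Longrightarrow> \<bar>A (replicate N d)\<bar> \<le> K"
    and ds: "length ds = N" "\<And>d. d \<in> set ds \<Longrightarrow> Bnorm B d = 1"
  shows "\<bar>A ds\<bar> \<le> K"
proof (cases "N = 0")
  case True
  \<comment> \<open>Without arguments the diagonal hypothesis is the claim itself, but it can only
    be invoked at some unit vector.\<close>
  obtain e where "Bnorm B e = 1" using unit_multiple[of undefined] by blast
  then show ?thesis using diag[of e] True ds by simp
next
  case False
  define g where "g f = A (map f [0..<N])" for f
  \<comment> \<open>Entries beyond \<open>N\<close> are constrained as well, which makes
    \<open>K0\<close> a full product of spheres and hence compact.\<close>
  define K0 where "K0 = {f::nat \<Rightarrow> 'a. \<forall>i. f i \<in> {z. Bnorm B z \<in> {1}}}"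
  have K0: "f \<in> K0 \<longleftrightarrow> (\<forall>i. Bnorm B (f i) = 1)" for f by (simp add: K0_def)
  have cK0: "compact K0" unfolding K0_def by (intro compact_Pi_UNIV compact_Bnorm) auto
  have cg: "continuous_on S (\<lambda>f. \<bar>g f\<bar>)" for S
    using sym_multilinear_continuous_on[OF A, of "[]" N S]
    by (auto simp: g_def intro!: continuous_intros)
  obtain e0 where e0: "Bnorm B e0 = 1" using unit_multiple[of undefined] by blast
  have "K0 \<noteq> {}" using e0 by (auto simp: K0_def intro!: exI[of _ "\<lambda>_. e0"])
  then obtain f0 where f0: "f0 \<in> K0" "\<And>f. f \<in> K0 \<Longrightarrow> \<bar>g f\<bar> \<le> \<bar>g f0\<bar>"
    using continuous_attains_sup[OF cK0 _ cg] by blast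
  define w where "w = \<bar>g f0\<bar>"
  have "w \<ge> 0" by (simp add: w_def)
  define K1 where "K1 = K0 \<inter> {f. \<bar>g f\<bar> = w}"
  have cK1: "compact K1"
  proof -
    have "closed ((\<lambda>f. \<bar>g f\<bar>) -` {w})"
      using cg[of UNIV] by (intro continuous_closed_vimage) (auto simp: continuous_on_eq_continuous_at)
    then show ?thesis unfolding K1_def
      by (intro compact_Int_closed cK0) (simp add: vimage_def)
  qed
  \<comment> \<open>Taking an entry of a maximising tuple as reference direction ensures that the
    potential \<open>P\<close> is positive somewhere on \<open>K1\<close>.\<close>
  define e where "e = f0 0"
  define P where "P f = (\<Sum>i<N. B (f i) e)" for f
  have cP: "continuous_on K1 P"
  proof -
    have "continuous_on K1 (\<lambda>f. f i)" for i
      using continuous_on_product_then_coordinatewise[OF continuous_on_id] .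
    then show ?thesis unfolding P_def
      by (intro continuous_on_sum bounded_bilinear.continuous_on[OF bounded_bilinear_B] continuous_on_const)
  qed
  have "K1 \<noteq> {}" using f0 by (auto simp: K1_def w_def)
  then obtain f1 where f1: "f1 \<in> K1" "\<And>f. f \<in> K1 \<Longrightarrow> P f \<le> P f1"
    using continuous_attains_sup[OF cK1 _ cP] by blast
  have flip: "(\<lambda>i. s i *\<^sub>R f i) \<in> K1" if "f \<in> K1" "\<And>i. \<bar>s i\<bar> = 1" for f s
  proof -
    have "g (\<lambda>i. s i *\<^sub>R f i) = (\<Prod>i<N. s i) * g f"
      unfolding g_def using sym_multilinear_scale[OF A, of "[]" N s f] by simp
    moreover have "\<bar>\<Prod>i<N. s i\<bar> = 1" using that(2) by (simp add: abs_prod)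
    ultimately have "\<bar>g (\<lambda>i. s i *\<^sub>R f i)\<bar> = \<bar>g f\<bar>" by (simp add: abs_mult)
    then show ?thesis using that by (auto simp: K1_def K0 Bnorm_scaleR)
  qed
  \<comment> \<open>Sign changes keep a tuple in \<open>K1\<close>, so a negative term could be
    flipped to increase \<open>P\<close>.\<close>
  have pos: "0 \<le> B (f1 i) e" if "i < N" for i
  proof (rule ccontr)
    assume n: "\<not> 0 \<le> B (f1 i) e"
    define f where "f j = (if j = i then - 1 else 1) *\<^sub>R f1 j" for j
    have "f \<in> K1" unfolding f_def by (rule flip) (use f1 in auto)
    have "P f1 < P f" unfolding P_def
      using that n by (intro sum_strict_mono_ex1) (auto simp: f_def B_simps)
    then show False using f1(2)[OF \<open>f \<in> K1\<close>] by simp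
  qed
  \<comment> \<open>Flipping signs in \<open>f0\<close> makes every term nonnegative, and the term
    with index 0 equals 1.\<close>
  have "0 < P f1"
  proof -
    define f where "f j = (if B (f0 j) e < 0 then - 1 else 1) *\<^sub>R f0 j" for j
    have "f \<in> K1" unfolding f_def by (rule flip) (use f0 in \<open>auto simp: K1_def w_def\<close>)
    have "B (f0 0) e = 1"
      using f0(1) Bnorm_sq[of "f0 0"] by (simp add: e_def K0)
    then have "0 < B (f 0) e" by (simp add: f_def)
    then have "0 < P f" unfolding P_def
      using False by (intro sum_pos2[of _ 0]) (auto simp: f_def B_simps)
    then show ?thesis using f1(2)[OF \<open>f \<in> K1\<close>] by simp
  qed
  then obtain i where i: "i < N" "0 < B (f1 i) e"
    unfolding P_def by (smt (verit) lessThan_iff sum_nonpos)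
  have eq: "f1 j = f1 i" if j: "j < N" for j
  proof (rule ccontr)
    assume ne: "f1 j \<noteq> f1 i"
    then have "j \<noteq> i" by auto
    define T where "T = {..<N} - {i, j}"
    have T: "{..<N} = insert i (insert j T)" "finite T" "i \<notin> T" "j \<notin> T"
      using i j by (auto simp: T_def)
    obtain R where R: "mset R = image_mset f1 (mset_set T)" using ex_mset by blast
    have gR: "g (f1(i := a, j := b)) = A (a # b # R)" for a b
    proof -
      have "mset (map (f1(i := a, j := b)) [0..<N])
          = image_mset (f1(i := a, j := b)) (mset_set {..<N})"
        by (simp add: atLeast0LessThan)
      also have "\<dots> = {#a, b#} + image_mset (f1(i := a, j := b)) (mset_set T)"
        using T \<open>j \<noteq> i\<close> by simp
      also have "image_mset (f1(i := a, j := b)) (mset_set T) = image_mset f1 (mset_set T)"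
        using T by (intro image_mset_cong) auto
      finally show ?thesis unfolding g_def
        by (intro sym_multilinear_mset[OF A]) (simp_all add: R del: fun_upd_apply)
    qed
    have lenR: "length R + 2 = N"
      using arg_cong[OF R, of size] T(1) card_insert_disjoint[of T j] card_insert_disjoint[of "insert j T" i]
        T \<open>j \<noteq> i\<close> card_lessThan[of N] by simp
    have in0: "f1(i := a, j := b) \<in> K0" if "Bnorm B a = 1" "Bnorm B b = 1" for a b
      using that f1(1) by (auto simp: K1_def K0)
    have hom: "A ((c *\<^sub>R a) # (c *\<^sub>R a) # R) = c\<^sup>2 * A (a # a # R)" for a c
    proof -
      have "A (replicate 2 (c *\<^sub>R a) @ R) = c\<^sup>2 * A (replicate 2 a @ R)"
        using lenR by (intro sym_multilinear_scale_replicate[OF A]) simp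
      then show ?thesis by (simp add: numeral_2_eq_2)
    qed
    have bd: "\<bar>A (z # z # R)\<bar> \<le> w * (Bnorm B z)\<^sup>2" for z
    proof -
      obtain a where a: "Bnorm B a = 1" "z = Bnorm B z *\<^sub>R a" using unit_multiple .
      have "A (z # z # R) = (Bnorm B z)\<^sup>2 * A (a # a # R)" using a(2) hom by metis
      moreover have "\<bar>A (a # a # R)\<bar> \<le> w" using f0(2)[OF in0[OF a(1) a(1)]] by (simp add: gR w_def)
      ultimately show ?thesis by (simp add: abs_mult mult.commute mult_right_mono)
    qed
    define s where "s = f1 i + f1 j"
    have un: "Bnorm B (f1 i) = 1" "Bnorm B (f1 j) = 1" using f1(1) by (auto simp: K1_def K0)
    have "\<bar>A (s # s # R)\<bar> = w * (Bnorm B s)\<^sup>2" unfolding s_def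
    proof (rule sym_multilinear_polarized_max[OF A lenR bd un])
      show "\<bar>A (f1 i # f1 j # R)\<bar> = w"
        using gR[of "f1 i" "f1 j"] f1(1) by (simp add: K1_def)
    qed
    moreover obtain a where a: "Bnorm B a = 1" "s = Bnorm B s *\<^sub>R a" using unit_multiple .
    moreover have "A (s # s # R) = (Bnorm B s)\<^sup>2 * A (a # a # R)" using a(2) hom by metis
    moreover have se: "0 < B s e" using i pos[OF j] by (simp add: s_def B_simps)
    then have "s \<noteq> 0" by (auto simp: B_simps)
    ultimately have "\<bar>A (a # a # R)\<bar> = w" by (simp add: abs_mult)
    then have in1: "f1(i := a, j := a) \<in> K1" using in0[OF a(1) a(1)] by (simp add: K1_def gR)
    \<comment> \<open>Distinct unit vectors have a sum \<open>s\<close> of norm strictly below 2.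
      Hence replacing both by \<open>a\<close>, the normalised \<open>s\<close>, changes their
      contribution \<open>B s e\<close> to the strictly larger \<open>2 * B a e\<close>, against the
      maximality of \<open>f1\<close>.\<close>
    have "0 < (Bnorm B (f1 i - f1 j))\<^sup>2" using ne by force
    moreover have "(Bnorm B s)\<^sup>2 + (Bnorm B (f1 i - f1 j))\<^sup>2 = 2\<^sup>2"
      using Bnorm_parallelogram[of "f1 i" "f1 j"] un by (simp add: s_def)
    ultimately have "(Bnorm B s)\<^sup>2 < 2\<^sup>2" by linarith
    then have "Bnorm B s < 2" by (rule power2_less_imp_less) simp
    moreover have sa: "B s e = Bnorm B s * B a e"
      using arg_cong[OF a(2), of "\<lambda>z. B z e"] by (simp only: B_simps real_scaleR_def)
    moreover have "0 < B a e"
      using se Bnorm_pos[OF \<open>s \<noteq> 0\<close>] unfolding sa by (rule zero_less_mult_pos)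
    ultimately have "B s e < 2 * B a e" by simp
    moreover have "P (f1(i := a, j := a)) = 2 * B a e + (\<Sum>k\<in>T. B (f1 k) e)"
    proof -
      have "(\<Sum>k\<in>T. B ((f1(i := a, j := a)) k) e) = (\<Sum>k\<in>T. B (f1 k) e)"
        using T by (intro sum.cong) auto
      then show ?thesis unfolding P_def T(1) using T \<open>j \<noteq> i\<close> by simp
    qed
    moreover have "P f1 = B s e + (\<Sum>k\<in>T. B (f1 k) e)"
      unfolding P_def T(1) using T \<open>j \<noteq> i\<close> by (simp add: s_def B_simps)
    ultimately show False using f1(2)[OF in1] by simp
  qed
  have "map f1 [0..<N] = replicate N (f1 i)"
    using eq by (intro nth_equalityI) auto
  then have "w = \<bar>A (replicate N (f1 i))\<bar>" using f1(1) by (simp add: K1_def g_def)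
  also have "\<dots> \<le> K" using f1(1) by (intro diag) (simp add: K1_def K0)
  finally have "w \<le> K" .
  \<comment> \<open>Padding with \<open>e0\<close> places the given list in
    \<open>K0\<close>.\<close>
  define f where "f k = (if k < N then ds ! k else e0)" for k
  have "f \<in> K0" using ds e0 by (auto simp: K0 f_def)
  moreover have "g f = A ds"
    unfolding g_def using ds by (intro arg_cong[of _ _ A] nth_equalityI) (auto simp: f_def)
  ultimately show ?thesis using f0(2)[of f] \<open>w \<le> K\<close> by (simp add: w_def)
qed

text \<open>Both vectors are normalised and their norms pulled out by homogeneity, so the mixed
  values inherit the diagonal constant \<open>K\<close> unchanged.\<close>

corollary sym_multilinear_bound_two:
  assumes A: "sym_multilinear (n + k) A"
    and diag: "\<And>d. Bnorm B d = 1 \<Longrightarrow> \<bar>A (replicate (n + k) d)\<bar> \<le> K"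
  shows "\<bar>A (replicate n d @ replicate k v)\<bar> \<le> K * Bnorm B d ^ n * Bnorm B v ^ k"
proof -
  obtain a where a: "Bnorm B a = 1" "d = Bnorm B d *\<^sub>R a" using unit_multiple .
  obtain b where b: "Bnorm B b = 1" "v = Bnorm B v *\<^sub>R b" using unit_multiple .
  have "A (replicate n d @ replicate k v) = Bnorm B d ^ n * A (replicate n a @ replicate k v)"
    using sym_multilinear_scale_replicate[OF A, of "replicate k v" n "Bnorm B d" a] a(2) by simp
  also have "A (replicate n a @ replicate k v) = A (replicate k v @ replicate n a)"
    by (intro sym_multilinear_mset[OF A]) auto
  also have "\<dots> = Bnorm B v ^ k * A (replicate k b @ replicate n a)"
    using sym_multilinear_scale_replicate[OF A, of "replicate n a" k "Bnorm B v" b] b(2) by simp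
  finally have "\<bar>A (replicate n d @ replicate k v)\<bar>
      = Bnorm B d ^ n * Bnorm B v ^ k * \<bar>A (replicate k b @ replicate n a)\<bar>"
    by (simp add: abs_mult)
  also have "\<dots> \<le> Bnorm B d ^ n * Bnorm B v ^ k * K"
    using a(1) b(1)
    by (intro mult_left_mono sym_multilinear_bound_units[OF A diag]) auto
  finally show ?thesis by (simp add: mult_ac)
qed

end

subsection \<open>Iterated derivatives and Taylor expansion\<close>

lemma has_derivative_imp_line:
  fixes f :: "'a::real_normed_vector \<Rightarrow> real"
  assumes "(f has_derivative f') (at (a + t *\<^sub>R v))"
  shows "((\<lambda>s. f (a + s *\<^sub>R v)) has_field_derivative f' v) (at t)"
proof -
  have "((\<lambda>s. a + s *\<^sub>R v) has_derivative (\<lambda>s. s *\<^sub>R v)) (at t)"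
    by (auto intro!: derivative_eq_intros)
  from has_derivative_compose[OF this assms]
  have "((\<lambda>s. f (a + s *\<^sub>R v)) has_derivative (\<lambda>s. f' (s *\<^sub>R v))) (at t)" .
  moreover have "f' (s *\<^sub>R v) = f' v * s" for s
    using linear_scale[OF has_derivative_linear[OF assms], of s v] by simp
  ultimately show ?thesis by (simp add: has_field_derivative_def mult_commute_abs)
qed

lemma iter_deriv_append: "iter_deriv f (ds @ es) = iter_deriv (iter_deriv f es) ds"
  by (induction ds) auto

lemma times_cont_diff_differentiable:
  "times_cont_diff n f \<Longrightarrow> length ds < n \<Longrightarrow> iter_deriv f ds differentiable (at x)"
  by (simp add: times_cont_diff_def)

lemma iter_deriv_line:
  assumes "times_cont_diff n f" "length ds < n"
  shows "((\<lambda>s. iter_deriv f ds (a + s *\<^sub>R v)) has_field_derivative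
           iter_deriv f (v # ds) (a + t *\<^sub>R v)) (at t)"
proof -
  have "(iter_deriv f ds has_derivative frechet_derivative (iter_deriv f ds) (at (a + t *\<^sub>R v)))
      (at (a + t *\<^sub>R v))"
    using times_cont_diff_differentiable[OF assms] frechet_derivative_works by blast
  then show ?thesis using has_derivative_imp_line by fastforce
qed

lemma iter_deriv_isCont:
  "times_cont_diff n f \<Longrightarrow> length ds \<le> n \<Longrightarrow> isCont (iter_deriv f ds) x"
  by (simp add: times_cont_diff_def continuous_on_eq_continuous_at)

lemma times_cont_diff_iter_deriv:
  assumes "times_cont_diff n f" "m + length es \<le> n"
  shows "times_cont_diff m (iter_deriv f es)"
  unfolding times_cont_diff_def iter_deriv_append[symmetric]
  using assms by (auto simp: times_cont_diff_def)

text \<open>The mean value theorem is applied twice: in direction \<open>a\<close> to the increment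
  of \<open>f\<close> along \<open>s *\<^sub>R b\<close>, then in direction \<open>b\<close> to the
  derivative \<open>iter_deriv f [a]\<close>.\<close>

lemma second_difference_mean_value:
  assumes "times_cont_diff 2 f" "0 < s"
  shows "\<exists>\<sigma> \<tau>. 0 < \<sigma> \<and> \<sigma> < s \<and> 0 < \<tau> \<and> \<tau> < s \<and>
    f (x + s *\<^sub>R a + s *\<^sub>R b) - f (x + s *\<^sub>R a) - f (x + s *\<^sub>R b) + f x
      = s * s * iter_deriv f [b, a] (x + \<sigma> *\<^sub>R a + \<tau> *\<^sub>R b)"
proof -
  define g where "g t = f (x + s *\<^sub>R b + t *\<^sub>R a) - f (x + t *\<^sub>R a)" for t
  define g' where "g' t = iter_deriv f [a] (x + s *\<^sub>R b + t *\<^sub>R a) - iter_deriv f [a] (x + t *\<^sub>R a)" for t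
  have "(g has_field_derivative g' t) (at t)" for t
    unfolding g_def g'_def
    using iter_deriv_line[OF assms(1), of "[]"] by (intro DERIV_diff) simp_all
  then obtain \<sigma> where \<sigma>: "0 < \<sigma>" "\<sigma> < s" "g s - g 0 = (s - 0) * g' \<sigma>"
    using MVT2[OF assms(2), of g g'] by blast
  define k where "k t = iter_deriv f [a] (x + \<sigma> *\<^sub>R a + t *\<^sub>R b)" for t
  define k' where "k' t = iter_deriv f [b, a] (x + \<sigma> *\<^sub>R a + t *\<^sub>R b)" for t
  have "(k has_field_derivative k' t) (at t)" for t
    unfolding k_def k'_def using iter_deriv_line[OF assms(1), of "[a]"] by simp
  then obtain \<tau> where \<tau>: "0 < \<tau>" "\<tau> < s" "k s - k 0 = (s - 0) * k' \<tau>"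
    using MVT2[OF assms(2), of k k'] by blast
  have "g' \<sigma> = k s - k 0" by (simp add: g'_def k_def add_ac)
  then have "g s - g 0 = s * s * k' \<tau>" using \<sigma> \<tau> by simp
  moreover have "g s - g 0 = f (x + s *\<^sub>R a + s *\<^sub>R b) - f (x + s *\<^sub>R a) - f (x + s *\<^sub>R b) + f x"
    by (simp add: g_def add_ac)
  ultimately show ?thesis using \<sigma> \<tau> unfolding k'_def by metis
qed

text \<open>The second difference is symmetric in \<open>a\<close> and \<open>b\<close>; divided by
  the squared step it converges to either mixed derivative, by continuity of both.\<close>

theorem iter_deriv_swap:
  assumes "times_cont_diff 2 f"
  shows "iter_deriv f [a, b] = iter_deriv f [b, a]"
proof
  fix x
  define r where "r n = inverse (real (Suc n))" for n
  have r: "r n > 0" for n by (simp add: r_def)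
  have r0: "r \<longlonglongrightarrow> 0" unfolding r_def by (rule LIMSEQ_inverse_real_of_nat)
  have lim: "(\<lambda>n. (f (x + r n *\<^sub>R a + r n *\<^sub>R b) - f (x + r n *\<^sub>R a) - f (x + r n *\<^sub>R b) + f x) / (r n * r n))
      \<longlonglongrightarrow> iter_deriv f [b, a] x" for a b
  proof -
    have "\<exists>\<sigma> \<tau>. 0 < \<sigma> \<and> \<sigma> < r n \<and> 0 < \<tau> \<and> \<tau> < r n \<and>
      f (x + r n *\<^sub>R a + r n *\<^sub>R b) - f (x + r n *\<^sub>R a) - f (x + r n *\<^sub>R b) + f x
      = r n * r n * iter_deriv f [b, a] (x + \<sigma> *\<^sub>R a + \<tau> *\<^sub>R b)" for n
      using second_difference_mean_value[OF assms r[of n], of x a b] .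
    then obtain \<sigma> \<tau> where st: "\<And>n. 0 < \<sigma> n" "\<And>n. \<sigma> n < r n" "\<And>n. 0 < \<tau> n" "\<And>n. \<tau> n < r n"
      and eq: "\<And>n. f (x + r n *\<^sub>R a + r n *\<^sub>R b) - f (x + r n *\<^sub>R a) - f (x + r n *\<^sub>R b) + f x
      = r n * r n * iter_deriv f [b, a] (x + \<sigma> n *\<^sub>R a + \<tau> n *\<^sub>R b)"
      by metis
    have s0: "\<sigma> \<longlonglongrightarrow> 0" and t0: "\<tau> \<longlonglongrightarrow> 0"
      by (rule real_tendsto_sandwich[OF _ _ tendsto_const r0];
          use st in \<open>auto intro!: always_eventually less_imp_le\<close>)+
    have "(\<lambda>n. x + \<sigma> n *\<^sub>R a + \<tau> n *\<^sub>R b) \<longlonglongrightarrow> x + 0 *\<^sub>R a + 0 *\<^sub>R b"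
      by (intro tendsto_intros s0 t0)
    then have "(\<lambda>n. iter_deriv f [b, a] (x + \<sigma> n *\<^sub>R a + \<tau> n *\<^sub>R b)) \<longlonglongrightarrow> iter_deriv f [b, a] x"
      using isCont_tendsto_compose[OF iter_deriv_isCont[OF assms, of "[b, a]" x]] by simp
    then show ?thesis unfolding eq using r by (simp add: less_imp_neq[symmetric])
  qed
  have eqq: "f (x + r n *\<^sub>R a + r n *\<^sub>R b) - f (x + r n *\<^sub>R a) - f (x + r n *\<^sub>R b) + f x
     = f (x + r n *\<^sub>R b + r n *\<^sub>R a) - f (x + r n *\<^sub>R b) - f (x + r n *\<^sub>R a) + f x" for n
    by (simp add: add_ac)
  show "iter_deriv f [a, b] x = iter_deriv f [b, a] x"
    using LIMSEQ_unique[OF lim[of b a] lim[of a b, unfolded eqq]] .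
qed

lemma iter_deriv_mset:
  assumes "times_cont_diff n f" "length ds \<le> n" "mset ds = mset es"
  shows "iter_deriv f ds = iter_deriv f es"
  using assms(2,3)
proof (induction "length ds" arbitrary: ds es rule: less_induct)
  case less
  show ?case
  proof (cases ds)
    case Nil
    then show ?thesis using less.prems by simp
  next
    case (Cons d ds')
    then obtain e es' where es: "es = e # es'"
      using less.prems(2) by (cases es) auto
    show ?thesis
    proof (cases "d = e")
      case True
      then have "iter_deriv f ds' = iter_deriv f es'"
        using less.prems Cons es by (intro less.hyps) auto
      then show ?thesis using True Cons es by simp
    next
      case False
      \<comment> \<open>When the heads differ, the induction hypothesis rearranges each tail so that
        the other head comes first; exchanging the two leading directions then finishes.\<close>
      then have "e \<in># mset ds'" using less.prems(2) Cons es by (metis add_mset_remove_trivial_eq insert_noteq_member mset.simps(2))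
      then obtain R where R: "mset ds' = add_mset e (mset R)"
        by (metis ex_mset insert_DiffM)
      have R': "mset es' = add_mset d (mset R)"
        using less.prems(2) R unfolding Cons es by (simp add: add_mset_commute)
      have len: "length ds' = Suc (length R)" "length es' = Suc (length R)"
        using arg_cong[OF R, of size] arg_cong[OF R', of size] by auto
      have "iter_deriv f ds' = iter_deriv f (e # R)"
        using less.prems Cons R by (intro less.hyps) auto
      moreover have "iter_deriv f es' = iter_deriv f (d # R)"
        using less.prems Cons R' len by (intro less.hyps) auto
      moreover have "iter_deriv f (d # e # R) = iter_deriv f (e # d # R)"
        using iter_deriv_swap[OF times_cont_diff_iter_deriv[OF assms(1), of 2 R], of d e]
          less.prems len Cons by simp
      ultimately show ?thesis by (simp add: Cons es)
    qed
  qed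
qed

lemma sym_multilinear_iter_deriv:
  assumes "times_cont_diff n f" "k \<le> n"
  shows "sym_multilinear k (\<lambda>ds. iter_deriv f ds x)"
  unfolding sym_multilinear_def
proof (intro conjI allI impI)
  fix ds :: "'a list" assume "Suc (length ds) = k"
  then have "iter_deriv f ds differentiable (at x)"
    using assms by (intro times_cont_diff_differentiable) auto
  then show "linear (\<lambda>d. iter_deriv f (d # ds) x)"
    using linear_frechet_derivative by simp
next
  fix ds es :: "'a list" assume "length ds = k" "mset ds = mset es"
  then show "iter_deriv f ds x = iter_deriv f es x"
    using iter_deriv_mset[OF assms(1), of ds es] assms(2) by simp
qed

text \<open>The derivative of the remainder of \<open>\<phi> 0\<close> is the remainder, one order
  lower, of \<open>\<phi> 1\<close>. Treating the derivatives as a family \<open>\<phi>\<close>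
  turns this shift into the induction step.\<close>

lemma taylor_remainder_real:
  fixes \<phi> :: "nat \<Rightarrow> real \<Rightarrow> real"
  assumes "\<And>i t. i < n \<Longrightarrow> (\<phi> i has_field_derivative \<phi> (Suc i) t) (at t)"
    and "\<And>t. 0 \<le> t \<Longrightarrow> t \<le> 1 \<Longrightarrow> \<bar>\<phi> n t - \<phi> n 0\<bar> \<le> K * t"
    and "0 \<le> t" "t \<le> 1"
  shows "\<bar>\<phi> 0 t - (\<Sum>i\<le>n. \<phi> i 0 * t ^ i / fact i)\<bar> \<le> K * t ^ (n + 1) / fact (n + 1)"
  using assms
proof (induction n arbitrary: \<phi> t)
  case 0
  then show ?case by simp
next
  case (Suc n)
  define R where "R s = \<phi> 0 s - (\<Sum>i\<le>Suc n. \<phi> i 0 * s ^ i / fact i)" for s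
  define R' where "R' s = \<phi> 1 s - (\<Sum>i\<le>n. \<phi> (Suc i) 0 * s ^ i / fact i)" for s
  have bd: "\<bar>R' s\<bar> \<le> K * s ^ (n + 1) / fact (n + 1)" if "0 \<le> s" "s \<le> 1" for s
    unfolding R'_def using Suc.IH[of "\<lambda>i. \<phi> (Suc i)" s] Suc.prems(1,2) that by simp
  have dR: "(R has_field_derivative R' s) (at s)" for s
  proof -
    have "((\<lambda>s. \<Sum>i\<le>n. \<phi> (Suc i) 0 * s ^ Suc i / fact (Suc i)) has_field_derivative
        (\<Sum>i\<le>n. \<phi> (Suc i) 0 * s ^ i / fact i)) (at s)"
    proof (intro DERIV_sum)
      fix i
      show "((\<lambda>s. \<phi> (Suc i) 0 * s ^ Suc i / fact (Suc i)) has_field_derivative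
        \<phi> (Suc i) 0 * s ^ i / fact i) (at s)"
        by (auto intro!: derivative_eq_intros simp del: power_Suc simp: divide_simps) 
    qed
    then have "((\<lambda>s. \<phi> 0 s - (\<phi> 0 0 + (\<Sum>i\<le>n. \<phi> (Suc i) 0 * s ^ Suc i / fact (Suc i)))) has_field_derivative
        \<phi> 1 s - (0 + (\<Sum>i\<le>n. \<phi> (Suc i) 0 * s ^ i / fact i))) (at s)"
      using Suc.prems(1)[of 0 s] by (intro DERIV_diff DERIV_add DERIV_const) auto
    then show ?thesis by (simp add: R_def[abs_def] R'_def sum.atMost_Suc_shift del: sum.atMost_Suc)
  qed
  have dK: "((\<lambda>s. K * s ^ (n + 2) / fact (n + 2)) has_field_derivative K * s ^ (n + 1) / fact (n + 1)) (at s)" for s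
    by (auto intro!: derivative_eq_intros simp del: power_Suc simp: divide_simps)
  have R0: "R 0 = 0" by (simp add: R_def sum.atMost_Suc_shift del: sum.atMost_Suc)
  \<comment> \<open>The bound on \<open>R'\<close> is integrated by monotonicity: the bounding
    monomial minus \<open>R\<close>, and likewise plus \<open>R\<close>, is nondecreasing on the
    interval.\<close>
  have "K * 0 ^ (n + 2) / fact (n + 2) - R 0 \<le> K * t ^ (n + 2) / fact (n + 2) - R t"
  proof (rule DERIV_nonneg_imp_nondecreasing[OF \<open>0 \<le> t\<close>])
    fix s assume "0 \<le> s" "s \<le> t"
    then show "\<exists>y. ((\<lambda>s. K * s ^ (n + 2) / fact (n + 2) - R s) has_field_derivative y) (at s) \<and> 0 \<le> y"
      using bd[of s] Suc.prems(4) 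
      by (intro exI[of _ "K * s ^ (n + 1) / fact (n + 1) - R' s"] conjI DERIV_diff[OF dK dR]) auto
  qed
  moreover have "K * 0 ^ (n + 2) / fact (n + 2) + R 0 \<le> K * t ^ (n + 2) / fact (n + 2) + R t"
  proof (rule DERIV_nonneg_imp_nondecreasing[OF \<open>0 \<le> t\<close>])
    fix s assume "0 \<le> s" "s \<le> t"
    then show "\<exists>y. ((\<lambda>s. K * s ^ (n + 2) / fact (n + 2) + R s) has_field_derivative y) (at s) \<and> 0 \<le> y"
      using bd[of s] Suc.prems(4) 
      by (intro exI[of _ "K * s ^ (n + 1) / fact (n + 1) + R' s"] conjI DERIV_add[OF dK dR]) auto
  qed
  ultimately have "\<bar>R t\<bar> \<le> K * t ^ (n + 2) / fact (n + 2)" using R0 by simp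
  then show ?case by (simp add: R_def)
qed

lemma taylor_remainder:
  assumes "times_cont_diff n f"
    and "\<And>t. 0 \<le> t \<Longrightarrow> t \<le> 1 \<Longrightarrow>
      \<bar>iter_deriv f (replicate n (y - x)) (x + t *\<^sub>R (y - x)) - iter_deriv f (replicate n (y - x)) x\<bar> \<le> K * t"
  shows "\<bar>f y - taylor n f y x\<bar> \<le> K / fact (n + 1)"
proof -
  define \<phi> where "\<phi> i t = iter_deriv f (replicate i (y - x)) (x + t *\<^sub>R (y - x))" for i t
  have "\<bar>\<phi> 0 1 - (\<Sum>i\<le>n. \<phi> i 0 * 1 ^ i / fact i)\<bar> \<le> K * 1 ^ (n + 1) / fact (n + 1)"
    using assms iter_deriv_line[OF assms(1), of "replicate _ (y - x)" x "y - x"]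
    by (intro taylor_remainder_real) (auto simp: \<phi>_def)
  moreover have "(\<Sum>i\<le>n. \<phi> i 0 * 1 ^ i / fact i) = taylor n f y x"
  proof -
    have "{..n} = insert 0 {1..n}" by auto
    then show ?thesis by (simp add: taylor_def \<phi>_def)
  qed
  ultimately show ?thesis by (simp add: \<phi>_def)
qed

subsection \<open>Convexity of the models\<close>

lemma convex_on_line:
  fixes g :: "'a::real_vector \<Rightarrow> real"
  assumes "convex_on UNIV g"
  shows "convex_on UNIV (\<lambda>t::real. g (a + t *\<^sub>R v))"
proof (rule convex_onI)
  fix t x y :: real assume t: "0 < t" "t < 1"
  have "a + ((1 - t) *\<^sub>R x + t *\<^sub>R y) *\<^sub>R v = (1 - t) *\<^sub>R (a + x *\<^sub>R v) + t *\<^sub>R (a + y *\<^sub>R v)"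
    by (simp add: algebra_simps)
  then show "g (a + ((1 - t) *\<^sub>R x + t *\<^sub>R y) *\<^sub>R v) \<le> (1 - t) * g (a + x *\<^sub>R v) + t * g (a + y *\<^sub>R v)"
    using convex_onD[OF assms, of t] t by simp
qed simp

lemma convex_on_lineI:
  fixes g :: "'a::real_vector \<Rightarrow> real"
  assumes "\<And>a v. convex_on UNIV (\<lambda>t::real. g (a + t *\<^sub>R v))"
  shows "convex_on UNIV g"
proof (rule convex_onI)
  fix t :: real and x y :: 'a assume t: "0 < t" "t < 1"
  have "g (x + ((1 - t) *\<^sub>R 0 + t *\<^sub>R 1) *\<^sub>R (y - x)) \<le> (1 - t) * g (x + 0 *\<^sub>R (y - x)) + t * g (x + 1 *\<^sub>R (y - x))"
    using convex_onD[OF assms[of x "y - x"], of t 0 1] t by simp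
  moreover have "x + ((1 - t) *\<^sub>R 0 + t *\<^sub>R 1) *\<^sub>R (y - x) = (1 - t) *\<^sub>R x + t *\<^sub>R y"
    by (simp add: algebra_simps)
  ultimately show "g ((1 - t) *\<^sub>R x + t *\<^sub>R y) \<le> (1 - t) * g x + t * g y" by simp
qed simp

text \<open>The second derivative is asked for only pointwise, as an existential, because for powers
  of the norm its expression differs at the centre.\<close>

lemma convex_on_second_derivI:
  fixes g g' :: "real \<Rightarrow> real"
  assumes "\<And>t. (g has_field_derivative g' t) (at t)"
    and "\<And>t. \<exists>c. (g' has_field_derivative c) (at t) \<and> 0 \<le> c"
  shows "convex_on UNIV g"
proof (rule convex_on_realI[where f' = g'])
  show "g' x \<le> g' y" if "x \<le> y" for x y
    by (rule DERIV_nonneg_imp_nondecreasing[OF that]) (rule assms(2))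
qed (use assms(1) in auto)

lemma grad_apply:
  assumes "(g has_derivative g') (at y)"
  shows "blinfun_apply (grad g y) = g'"
  using frechet_derivative_at[OF assms] has_derivative_bounded_linear[OF assms]
  by (simp add: grad_def bounded_linear_Blinfun_apply)

lemma convex_on_grad_le:
  assumes "convex_on UNIV g" "g differentiable (at y)"
  shows "g y + grad g y (z - y) \<le> g z"
proof -
  obtain g' where g': "(g has_derivative g') (at y)" using assms(2) by (auto simp: differentiable_def)
  have "((\<lambda>s. g (y + s *\<^sub>R (z - y))) has_field_derivative g' (z - y)) (at 0)"
    using g' by (intro has_derivative_imp_line) simp
  then have "g' (z - y) * (1 - 0) \<le> g (y + 1 *\<^sub>R (z - y)) - g (y + 0 *\<^sub>R (z - y))"
    by (intro convex_on_imp_above_tangent[OF convex_on_line[OF assms(1)]]) auto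
  then show ?thesis by (simp add: grad_apply[OF g'])
qed

lemma convex_on_iter_deriv_nonneg:
  assumes f: "times_cont_diff 2 f" and conv: "convex_on UNIV f"
  shows "0 \<le> iter_deriv f [v, v] y"
proof (rule ccontr)
  assume "\<not> 0 \<le> iter_deriv f [v, v] y"
  define \<phi> where "\<phi> t = f (y + t *\<^sub>R v)" for t
  define \<phi>' where "\<phi>' t = iter_deriv f [v] (y + t *\<^sub>R v)" for t
  have d1: "(\<phi> has_field_derivative \<phi>' t) (at t)" for t
    unfolding \<phi>_def \<phi>'_def using iter_deriv_line[OF f, of "[]" y v t] by simp
  have "(\<phi>' has_field_derivative iter_deriv f [v, v] (y + 0 *\<^sub>R v)) (at 0)"
    unfolding \<phi>'_def using iter_deriv_line[OF f, of "[v]" y v 0] by simp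
  then obtain d where d: "d > 0" "\<And>h. h > 0 \<Longrightarrow> h < d \<Longrightarrow> \<phi>' (0 + h) < \<phi>' 0"
    using DERIV_neg_dec_right[of \<phi>' "iter_deriv f [v, v] (y + 0 *\<^sub>R v)" 0]
      \<open>\<not> 0 \<le> iter_deriv f [v, v] y\<close> by auto
  have ab: "\<phi>' c * (x - c) \<le> \<phi> x - \<phi> c" for x c
    using convex_on_line[OF conv, of y v] d1[of c]
    by (intro convex_on_imp_above_tangent[of UNIV]) (auto simp: \<phi>_def[abs_def])
  \<comment> \<open>Adding the tangent inequalities at 0 and at \<open>d / 2\<close> shows that the
    slope cannot decrease between them, against the choice of \<open>d\<close>.\<close>
  have "\<phi>' 0 * (d / 2) \<le> \<phi>' (d / 2) * (d / 2)"
    using ab[of 0 "d / 2"] ab[of "d / 2" 0] by simp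
  then show False using d(1) d(2)[of "d / 2"] by simp
qed

lemma taylor_altdef: "taylor n f y x = (\<Sum>i\<le>n. 1 / fact i * iter_deriv f (replicate i (y - x)) x)"
proof -
  have "{..n} = insert 0 {1..n}" by auto
  then show ?thesis by (simp add: taylor_def)
qed

text \<open>Differentiation reproduces the Taylor form: the derivative in direction \<open>w\<close>
  is the polynomial of one order less for \<open>iter_deriv f [w]\<close>. Iterating it gives the
  second derivative of a model along a line.\<close>

lemma taylor_has_derivative:
  assumes "times_cont_diff (Suc n) f"
  shows "((\<lambda>y. taylor (Suc n) f y x) has_derivative (\<lambda>w. taylor n (iter_deriv f [w]) y x)) (at y)"
proof -
  define A where "A ds = iter_deriv f ds x" for ds
  have "((\<lambda>y. A (replicate (Suc i) (y - x))) has_derivative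
        (\<lambda>w. real (Suc i) * A (replicate i (y - x) @ [w]))) (at y)" if "i \<le> n" for i
  proof -
    have "((\<lambda>z. A (replicate (Suc i) z)) has_derivative
        (\<lambda>w. real (Suc i) * A (replicate i (y - x) @ [w]))) (at (y - x))"
      using sym_multilinear_diag_has_derivative[OF sym_multilinear_iter_deriv[OF assms(1), of "Suc i" x],
          of "[]" "Suc i" "y - x" UNIV] that
      by (simp add: A_def del: replicate_Suc)
    moreover have "((\<lambda>y. y - x) has_derivative (\<lambda>w. w)) (at y)"
      by (auto intro!: derivative_eq_intros)
    ultimately show ?thesis using has_derivative_compose[of "\<lambda>y. y - x" "\<lambda>w. w" y UNIV] by simp
  qed
  then have "((\<lambda>y. f x + (\<Sum>i\<le>n. 1 / fact (Suc i) * A (replicate (Suc i) (y - x)))) has_derivative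
        (\<lambda>w. 0 + (\<Sum>i\<le>n. 1 / fact (Suc i) * (real (Suc i) * A (replicate i (y - x) @ [w]))))) (at y)"
    by (intro has_derivative_add has_derivative_const has_derivative_sum has_derivative_mult_right) auto
  moreover have "taylor (Suc n) f y x = f x + (\<Sum>i\<le>n. 1 / fact (Suc i) * A (replicate (Suc i) (y - x)))" for y
    by (simp add: taylor_altdef A_def sum.atMost_Suc_shift del: sum.atMost_Suc replicate_Suc)
  moreover have "0 + (\<Sum>i\<le>n. 1 / fact (Suc i) * (real (Suc i) * A (replicate i (y - x) @ [w])))
      = taylor n (iter_deriv f [w]) y x" for w
    by (simp add: taylor_altdef A_def iter_deriv_append field_simps del: of_nat_Suc)
  ultimately show ?thesis by simp
qed

lemma taylor_line:
  assumes "times_cont_diff (Suc n) f"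
  shows "((\<lambda>s. taylor (Suc n) f (a + s *\<^sub>R v) x) has_field_derivative
           taylor n (iter_deriv f [v]) (a + t *\<^sub>R v) x) (at t)"
  using has_derivative_imp_line[OF taylor_has_derivative[OF assms]] .

section \<open>Powers of the norm, mixed Taylor errors and convexity of the models\<close>

context energy_norm begin

lemma Bnorm_le_norm: "\<exists>c>0. \<forall>x. Bnorm B x \<le> c * norm x"
proof -
  obtain K where K: "K > 0" "\<And>a b. norm (B a b) \<le> norm a * norm b * K"
    using bounded_bilinear.pos_bounded[OF bounded_bilinear_B] by blast
  have "Bnorm B x \<le> sqrt K * norm x" for x
  proof -
    have "B x x \<le> K * (norm x)\<^sup>2" using K(2)[of x x] by (simp add: power2_eq_square mult_ac)
    then have "Bnorm B x \<le> sqrt (K * (norm x)\<^sup>2)" by (simp add: Bnorm_def)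
    then show ?thesis by (simp add: real_sqrt_mult)
  qed
  then show ?thesis using K(1) by (intro exI[of _ "sqrt K"]) simp
qed

lemma Bnorm_has_derivative:
  assumes "y \<noteq> 0"
  shows "(Bnorm B has_derivative (\<lambda>w. B y w / Bnorm B y)) (at y)"
proof -
  have "((\<lambda>y. B y y) has_derivative (\<lambda>w. B y w + B w y)) (at y)"
    using bounded_bilinear.FDERIV[OF bounded_bilinear_B has_derivative_ident has_derivative_ident] .
  then have "((\<lambda>y. sqrt (B y y)) has_derivative (\<lambda>w. (B y w + B w y) * (inverse (sqrt (B y y)) / 2))) (at y)"
    using B_pos[OF assms] by (intro DERIV_compose_FDERIV[OF DERIV_real_sqrt]) auto
  moreover have "(B y w + B w y) * (inverse (sqrt (B y y)) / 2) = B y w / Bnorm B y" for w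
    using B_commute[of w y] by (simp add: Bnorm_def field_simps)
  ultimately show ?thesis by (simp add: Bnorm_def[abs_def])
qed

text \<open>Away from 0 this is the chain rule. At 0 the norm itself is not differentiable, but its
  power with exponent at least 2 is negligible against \<open>norm\<close>, and the formula vanishes
  there.\<close>

lemma Bnorm_power_has_derivative_0:
  assumes "k \<ge> 1"
  shows "((\<lambda>y. Bnorm B y ^ (k + 1)) has_derivative
           (\<lambda>w. real (k + 1) * Bnorm B y ^ (k - 1) * B y w)) (at y)"
proof (cases "y = 0")
  case False
  have "((\<lambda>y. Bnorm B y ^ (k + 1)) has_derivative
      (\<lambda>w. of_nat (k + 1) * (B y w / Bnorm B y) * Bnorm B y ^ (k + 1 - 1))) (at y)"
    by (intro has_derivative_power Bnorm_has_derivative False)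
  moreover have "of_nat (k + 1) * (B y w / Bnorm B y) * Bnorm B y ^ (k + 1 - 1)
      = real (k + 1) * Bnorm B y ^ (k - 1) * B y w" for w
    using assms False by (cases k) auto
  ultimately show ?thesis by simp
next
  case True
  obtain c where c: "c > 0" "\<And>x. Bnorm B x \<le> c * norm x" using Bnorm_le_norm by blast
  have b: "Bnorm B h ^ (k + 1) / norm h \<le> c * Bnorm B h ^ k" for h
  proof (cases "h = 0")
    case False
    then show ?thesis
      using mult_right_mono[OF c(2)[of h], of "Bnorm B h ^ k"] by (simp add: field_simps)
  qed (use c(1) assms in auto)
  have "((\<lambda>h. c * Bnorm B h ^ k) \<longlongrightarrow> c * Bnorm B 0 ^ k) (at 0)"
    using isCont_Bnorm[of 0] by (intro tendsto_intros) (simp add: isCont_def)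
  then have "((\<lambda>h. c * Bnorm B h ^ k) \<longlongrightarrow> 0) (at 0)" using assms by (simp add: power_0_left)
  then have "((\<lambda>h. Bnorm B h ^ (k + 1) / norm h) \<longlongrightarrow> 0) (at 0)"
    by (rule tendsto_0_le[where K = 1]) (use b c(1) in \<open>auto intro!: always_eventually\<close>)
  then have "((\<lambda>y. Bnorm B y ^ (k + 1)) has_derivative (\<lambda>w. 0)) (at 0)"
    by (simp add: has_derivative_at)
  then show ?thesis using True assms by (simp add: B_simps)
qed

lemma Bnorm_power_has_derivative:
  assumes "k \<ge> 1"
  shows "((\<lambda>y. Bnorm B (y - x) ^ (k + 1)) has_derivative
           (\<lambda>w. real (k + 1) * Bnorm B (y - x) ^ (k - 1) * B (y - x) w)) (at y)"
proof -
  have "((\<lambda>y. y - x) has_derivative (\<lambda>w. w)) (at y)" by (auto intro!: derivative_eq_intros)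
  from has_derivative_compose[OF this Bnorm_power_has_derivative_0[OF assms]] show ?thesis .
qed

lemma Bnorm_power_line:
  assumes "k \<ge> 1"
  shows "((\<lambda>s. Bnorm B (a + s *\<^sub>R v - x) ^ (k + 1)) has_field_derivative
           real (k + 1) * (Bnorm B (a + t *\<^sub>R v - x) ^ (k - 1) * B (a + t *\<^sub>R v - x) v)) (at t)"
  using has_derivative_imp_line[OF Bnorm_power_has_derivative[OF assms, of x "a + t *\<^sub>R v"]]
  by (simp add: mult.assoc)

text \<open>At a zero of \<open>a + s v - x\<close> the norm is not differentiable, but the second factor vanishes there.\<close>
lemma Bnorm_power_line_second:
  "\<exists>c. ((\<lambda>s. Bnorm B (a + s *\<^sub>R v - x) ^ k * B (a + s *\<^sub>R v - x) v) has_field_derivative c) (at t)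
     \<and> Bnorm B (a + t *\<^sub>R v - x) ^ k * (Bnorm B v)\<^sup>2 \<le> c"
proof -
  define l where "l s = a + s *\<^sub>R v - x" for s
  have dl: "((\<lambda>s. B (l s) v) has_field_derivative (Bnorm B v)\<^sup>2) (at t)"
  proof -
    have "B (l s) v = B (a - x) v + s * (Bnorm B v)\<^sup>2" for s
      by (simp add: l_def B_simps Bnorm_sq)
    then show ?thesis by (auto intro!: derivative_eq_intros)
  qed
  have "\<exists>c. ((\<lambda>s. Bnorm B (l s) ^ k * B (l s) v) has_field_derivative c) (at t)
     \<and> Bnorm B (l t) ^ k * (Bnorm B v)\<^sup>2 \<le> c"
  proof (cases "l t = 0")
    case True
    have "l s = (s - t) *\<^sub>R v" for s
      using True by (simp add: l_def algebra_simps)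
    \<comment> \<open>The factor \<open>s - t\<close> splits off with a continuous cofactor, which
      is Caratheodory's criterion for differentiability.\<close>
    then have "Bnorm B (l s) ^ k * B (l s) v - Bnorm B (l t) ^ k * B (l t) v
        = Bnorm B (l s) ^ k * (Bnorm B v)\<^sup>2 * (s - t)" for s
      by (simp add: B_simps Bnorm_sq)
    moreover have "isCont (\<lambda>s. Bnorm B (l s) ^ k * (Bnorm B v)\<^sup>2) t"
      unfolding l_def
      by (intro continuous_intros isCont_o2[where g = "Bnorm B", OF _ isCont_Bnorm])
    ultimately have "((\<lambda>s. Bnorm B (l s) ^ k * B (l s) v) has_field_derivative
        Bnorm B (l t) ^ k * (Bnorm B v)\<^sup>2) (at t)"
      by (intro iffD2[OF CARAT_DERIV] exI[of _ "\<lambda>s. Bnorm B (l s) ^ k * (Bnorm B v)\<^sup>2"] conjI allI) auto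
    then show ?thesis by blast
  next
    case False
    have "(Bnorm B has_derivative (\<lambda>w. B (l t) w / Bnorm B (l t))) (at (a - x + t *\<^sub>R v))"
      using Bnorm_has_derivative[OF False] by (simp add: l_def algebra_simps)
    from has_derivative_imp_line[OF this]
    have dn: "((\<lambda>s. Bnorm B (l s)) has_field_derivative B (l t) v / Bnorm B (l t)) (at t)"
      by (simp add: l_def algebra_simps)
    have "((\<lambda>s. Bnorm B (l s) ^ k * B (l s) v) has_field_derivative
        of_nat k * (B (l t) v / Bnorm B (l t) * Bnorm B (l t) ^ (k - Suc 0)) * B (l t) v
        + (Bnorm B v)\<^sup>2 * Bnorm B (l t) ^ k) (at t)"
      by (intro DERIV_mult DERIV_power dn dl)
    \<comment> \<open>Differentiating the norm power contributes a square times a nonnegative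
      factor, so it may be dropped from the lower bound.\<close>
    moreover have "0 \<le> of_nat k * (B (l t) v / Bnorm B (l t) * Bnorm B (l t) ^ (k - Suc 0)) * B (l t) v"
    proof -
      have "of_nat k * (B (l t) v / Bnorm B (l t) * Bnorm B (l t) ^ (k - Suc 0)) * B (l t) v
        = of_nat k * (B (l t) v * B (l t) v) * (Bnorm B (l t) ^ (k - Suc 0) / Bnorm B (l t))"
        by simp
      then show ?thesis by (simp only: mult_nonneg_nonneg divide_nonneg_nonneg zero_le_square
        zero_le_power Bnorm_nonneg of_nat_0_le_iff)
    qed
    ultimately show ?thesis by (intro exI conjI) (auto simp: mult.commute)
  qed
  then show ?thesis by (simp add: l_def)
qed

lemma convex_on_Bnorm_power:
  assumes "k \<ge> 1"
  shows "convex_on UNIV (\<lambda>y. Bnorm B (y - x) ^ (k + 1))"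
proof (rule convex_on_lineI, rule convex_on_second_derivI)
  fix a v t
  show "((\<lambda>s. Bnorm B (a + s *\<^sub>R v - x) ^ (k + 1)) has_field_derivative
     real (k + 1) * (Bnorm B (a + t *\<^sub>R v - x) ^ (k - 1) * B (a + t *\<^sub>R v - x) v)) (at t)"
    using Bnorm_power_line[OF assms] .
next
  fix a v t
  obtain c where c: "((\<lambda>s. Bnorm B (a + s *\<^sub>R v - x) ^ (k - 1) * B (a + s *\<^sub>R v - x) v)
        has_field_derivative c) (at t)" "Bnorm B (a + t *\<^sub>R v - x) ^ (k - 1) * (Bnorm B v)\<^sup>2 \<le> c"
    using Bnorm_power_line_second[of a v x "k - 1" t] by blast
  have "0 \<le> Bnorm B (a + t *\<^sub>R v - x) ^ (k - 1) * (Bnorm B v)\<^sup>2" by simp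
  with c(2) have "0 \<le> c" by linarith
  with c(1) show "\<exists>c. ((\<lambda>t. real (k + 1) * (Bnorm B (a + t *\<^sub>R v - x) ^ (k - 1) * B (a + t *\<^sub>R v - x) v))
      has_field_derivative c) (at t) \<and> 0 \<le> c"
    by (intro exI[of _ "real (k + 1) * c"] conjI DERIV_cmult) auto
qed

text \<open>The supremum in \<open>form_norm\<close> dominates a particular value only if the values
  are bounded above, which compactness of the unit ball provides. Exchanging \<open>y\<close> and
  \<open>z\<close> supplies the absolute value.\<close>

lemma lipschitz_deriv_unit:
  assumes f: "times_cont_diff n f" and lip: "lipschitz_deriv B n L f" and d: "Bnorm B d = 1"
  shows "\<bar>iter_deriv f (replicate n d) y - iter_deriv f (replicate n d) z\<bar> \<le> L * Bnorm B (y - z)"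
proof -
  have le: "iter_deriv f (replicate n d) y - iter_deriv f (replicate n d) z \<le> L * Bnorm B (y - z)" for y z
  proof -
    define A where "A ds = iter_deriv f ds y - iter_deriv f ds z" for ds
    have "sym_multilinear n A" unfolding A_def
      by (intro sym_multilinear_diff sym_multilinear_iter_deriv[OF f]) auto
    then have "continuous_on {d. Bnorm B d \<in> {0..1}} (\<lambda>d. A (replicate n d @ []))"
      by (intro has_derivative_continuous_on[OF sym_multilinear_diag_has_derivative]) auto
    then have "compact ((\<lambda>d. A (replicate n d)) ` {d. Bnorm B d \<in> {0..1}})"
      by (intro compact_continuous_image compact_Bnorm) auto
    then have "bdd_above ((\<lambda>d. A (replicate n d)) ` {d. Bnorm B d \<le> 1})"
      by (simp add: bounded_imp_bdd_above compact_imp_bounded)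
    then have "A (replicate n d) \<le> form_norm B n A"
      unfolding form_norm_def using d by (intro cSUP_upper) auto
    also have "\<dots> \<le> L * Bnorm B (y - z)"
      using lip by (simp add: lipschitz_deriv_def A_def[abs_def])
    finally show ?thesis by (simp add: A_def)
  qed
  show ?thesis using le[of y z] le[of z y] by (simp add: Bnorm_minus_commute[of z y] abs_le_iff)
qed

lemma lipschitz_deriv_nonneg:
  assumes "times_cont_diff n f" "lipschitz_deriv B n L f"
  shows "0 \<le> L"
proof -
  obtain e where e: "Bnorm B e = 1" using unit_multiple[of undefined] by blast
  show ?thesis using lipschitz_deriv_unit[OF assms e, of e 0] e by simp
qed

lemma lipschitz_deriv_mixed:
  assumes f: "times_cont_diff (n + k) f" and lip: "lipschitz_deriv B (n + k) L f"
  shows "\<bar>iter_deriv f (replicate n d @ replicate k v) y - iter_deriv f (replicate n d @ replicate k v) z\<bar>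
    \<le> L * Bnorm B (y - z) * Bnorm B d ^ n * Bnorm B v ^ k"
  by (rule sym_multilinear_bound_two[of n k "\<lambda>ds. iter_deriv f ds y - iter_deriv f ds z"])
     (use f lip in \<open>auto intro!: sym_multilinear_diff sym_multilinear_iter_deriv lipschitz_deriv_unit\<close>)

text \<open>Taylor's theorem is applied to \<open>iter_deriv f (replicate k v)\<close>. The case
  \<open>k = 0\<close> is the usual error bound, and \<open>k = 2\<close> controls the Hessian of
  the Taylor polynomial.\<close>

lemma taylor_error_mixed:
  assumes f: "times_cont_diff (n + k) f" and lip: "lipschitz_deriv B (n + k) L f"
  shows "\<bar>iter_deriv f (replicate k v) y - taylor n (iter_deriv f (replicate k v)) y x\<bar>
    \<le> L / fact (n + 1) * Bnorm B (y - x) ^ (n + 1) * Bnorm B v ^ k"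
proof -
  have "\<bar>iter_deriv f (replicate k v) y - taylor n (iter_deriv f (replicate k v)) y x\<bar>
    \<le> (L * Bnorm B (y - x) ^ (n + 1) * Bnorm B v ^ k) / fact (n + 1)"
  proof (rule taylor_remainder)
    show "times_cont_diff n (iter_deriv f (replicate k v))"
      by (rule times_cont_diff_iter_deriv[OF f]) simp
    fix t :: real assume "0 \<le> t" "t \<le> 1"
    then show "\<bar>iter_deriv (iter_deriv f (replicate k v)) (replicate n (y - x)) (x + t *\<^sub>R (y - x)) -
          iter_deriv (iter_deriv f (replicate k v)) (replicate n (y - x)) x\<bar>
         \<le> L * Bnorm B (y - x) ^ (n + 1) * Bnorm B v ^ k * t"
      using lipschitz_deriv_mixed[OF f lip, of "y - x" v "x + t *\<^sub>R (y - x)" x]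
      by (simp add: iter_deriv_append Bnorm_scaleR mult_ac)
  qed
  then show ?thesis by simp
qed

lemma taylor_error:
  assumes "times_cont_diff n f" "lipschitz_deriv B n L f"
  shows "\<bar>f y - taylor n f y x\<bar> \<le> L / fact (n + 1) * Bnorm B (y - x) ^ (n + 1)"
  using taylor_error_mixed[of n 0 f L] assms by simp

lemma model_con_differentiable:
  assumes "times_cont_diff n f" "n \<ge> 1"
  shows "(\<lambda>y. model_con B n M f y x) differentiable (at y)"
proof -
  obtain k where k: "n = Suc k" using assms(2) by (cases n) auto
  show ?thesis unfolding model_con_def
    using taylor_has_derivative[of k f x y] Bnorm_power_has_derivative[OF assms(2), of x y] assms(1) k
    by (intro differentiable_add differentiable_mult differentiable_const) (auto simp: differentiable_def)
qed

text \<open>The second derivative is the Taylor polynomial of \<open>iter_deriv f [v, v]\<close>,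
  which is nonnegative up to the mixed error. For \<open>n = 0\<close> the first-order polynomial is
  affine and the bound reduces to \<open>0 \<le> L\<close>.\<close>

lemma taylor_line_second:
  assumes f: "times_cont_diff (Suc n) f" and lip: "lipschitz_deriv B (Suc n) L f"
    and conv: "convex_on UNIV f"
  shows "\<exists>c. ((\<lambda>s. taylor n (iter_deriv f [v]) (a + s *\<^sub>R v) x) has_field_derivative c) (at t)
     \<and> - (L / fact n * (Bnorm B (a + t *\<^sub>R v - x) ^ n * (Bnorm B v)\<^sup>2)) \<le> c"
proof (cases n)
  case 0
  then show ?thesis using lipschitz_deriv_nonneg[OF f lip]
    by (intro exI[of _ 0]) (simp add: taylor_def)
next
  case (Suc k)
  have f1: "times_cont_diff (Suc k) (iter_deriv f [v])"
    by (rule times_cont_diff_iter_deriv[OF f]) (simp add: Suc)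
  have it: "iter_deriv (iter_deriv f [v]) [v] = iter_deriv f [v, v]"
    using iter_deriv_append[of f "[v]" "[v]"] by simp
  have f2: "times_cont_diff 2 f"
    using times_cont_diff_iter_deriv[OF f, of 2 "[]"] by (simp add: Suc)
  have "\<bar>iter_deriv f [v, v] (a + t *\<^sub>R v) - taylor k (iter_deriv f [v, v]) (a + t *\<^sub>R v) x\<bar>
      \<le> L / fact (k + 1) * Bnorm B (a + t *\<^sub>R v - x) ^ (k + 1) * (Bnorm B v)\<^sup>2"
    using taylor_error_mixed[of k 2 f L v "a + t *\<^sub>R v" x] f lip by (simp add: Suc numeral_2_eq_2)
  then have "- (L / fact n * (Bnorm B (a + t *\<^sub>R v - x) ^ n * (Bnorm B v)\<^sup>2))
      \<le> taylor k (iter_deriv f [v, v]) (a + t *\<^sub>R v) x"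
    using convex_on_iter_deriv_nonneg[OF f2 conv, of v "a + t *\<^sub>R v"] by (simp add: Suc)
  then show ?thesis using taylor_line[OF f1, of a v x t] unfolding it Suc by blast
qed

theorem convex_on_model_con:
  assumes f: "times_cont_diff n f" and "n \<ge> 1" and lip: "lipschitz_deriv B n L f"
    and conv: "convex_on UNIV f" and M: "real n * L \<le> M"
  shows "convex_on UNIV (\<lambda>y. model_con B n M f y x)"
proof -
  obtain k where k: "n = Suc k" using assms(2) by (cases n) auto
  show ?thesis unfolding model_con_def
  proof (rule convex_on_lineI, rule convex_on_second_derivI)
    fix a v t
    show "((\<lambda>t. taylor n f (a + t *\<^sub>R v) x + M / fact (n + 1) * Bnorm B (a + t *\<^sub>R v - x) ^ (n + 1))
       has_field_derivative taylor k (iter_deriv f [v]) (a + t *\<^sub>R v) x +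
         M / fact (n + 1) * (real (n + 1) * (Bnorm B (a + t *\<^sub>R v - x) ^ (n - 1) * B (a + t *\<^sub>R v - x) v))) (at t)"
      using f unfolding k by (intro DERIV_add DERIV_cmult taylor_line Bnorm_power_line) auto
  next
    fix a v t
    define r where "r = Bnorm B (a + t *\<^sub>R v - x) ^ k * (Bnorm B v)\<^sup>2"
    obtain c where c: "((\<lambda>s. taylor k (iter_deriv f [v]) (a + s *\<^sub>R v) x) has_field_derivative c) (at t)"
       "- (L / fact k * r) \<le> c"
      using taylor_line_second[of k f L v a x t] f lip conv unfolding k r_def by blast
    obtain c' where c': "((\<lambda>s. Bnorm B (a + s *\<^sub>R v - x) ^ k * B (a + s *\<^sub>R v - x) v)
        has_field_derivative c') (at t)" "r \<le> c'"
      using Bnorm_power_line_second[of a v x k t] unfolding r_def by blast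
    have "0 \<le> r" by (simp add: r_def)
    have "0 \<le> M" using M lipschitz_deriv_nonneg[OF f lip] by (smt (verit) mult_nonneg_nonneg of_nat_0_le_iff)
    \<comment> \<open>Passing from \<open>fact k\<close> to \<open>fact n\<close> costs the factor
      \<open>n\<close>; this is where the threshold \<open>real n * L \<le> M\<close> comes
      from.\<close>
    have "L / fact k = real n * L / fact n" by (simp add: k)
    also have "\<dots> \<le> M / fact n" using M by (intro divide_right_mono) auto
    finally have "L / fact k * r \<le> M / fact n * r" using \<open>0 \<le> r\<close> by (rule mult_right_mono)
    also have "\<dots> \<le> M / fact n * c'" using c'(2) \<open>0 \<le> M\<close> by (intro mult_left_mono) auto
    also have "\<dots> = M / fact (n + 1) * (real (n + 1) * c')"
      by (simp add: field_simps del: of_nat_Suc)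
    finally show "\<exists>c. ((\<lambda>t. taylor k (iter_deriv f [v]) (a + t *\<^sub>R v) x +
         M / fact (n + 1) * (real (n + 1) * (Bnorm B (a + t *\<^sub>R v - x) ^ (n - 1) * B (a + t *\<^sub>R v - x) v)))
         has_field_derivative c) (at t) \<and> 0 \<le> c"
      using c c'
      by (intro exI[of _ "c + M / fact (n + 1) * (real (n + 1) * c')"] conjI DERIV_add DERIV_cmult)
         (auto simp: k)
  qed
qed

end

subsection \<open>The descent inequality and the rate\<close>

context energy_norm begin

text \<open>Since \<open>n \<ge> 1\<close> and \<open>0 \<le> L\<close>, the convexity threshold
  implies \<open>L \<le> M\<close>, so the regularisation also absorbs the Taylor error.\<close>

lemma model_con_bounds:
  assumes f: "times_cont_diff n f" "lipschitz_deriv B n L f" and "n \<ge> 1" and M: "real n * L \<le> M"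
  shows "f y \<le> model_con B n M f y x"
    and "model_con B n M f y x \<le> f y + (M + L) / fact (n + 1) * Bnorm B (y - x) ^ (n + 1)"
    and "0 \<le> M + L" and "0 \<le> M"
proof -
  have L: "0 \<le> L" using lipschitz_deriv_nonneg[OF f] .
  have "1 * L \<le> real n * L" using L assms(3) by (intro mult_right_mono) auto
  then have "L \<le> M" using M by simp
  then show "0 \<le> M + L" "0 \<le> M" using L by auto
  have "L / fact (n + 1) * Bnorm B (y - x) ^ (n + 1) \<le> M / fact (n + 1) * Bnorm B (y - x) ^ (n + 1)"
    using \<open>L \<le> M\<close> by (intro mult_right_mono divide_right_mono) auto
  then show "f y \<le> model_con B n M f y x"
    using taylor_error[OF f, of y x] unfolding model_con_def by linarith
  show "model_con B n M f y x \<le> f y + (M + L) / fact (n + 1) * Bnorm B (y - x) ^ (n + 1)"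
    using taylor_error[OF f, of y x] unfolding model_con_def add_divide_distrib distrib_right by linarith
qed

text \<open>The objective model is a constraint model plus one convex power, so facts about
  \<open>model_con\<close> carry over.\<close>

lemma model_obj_altdef:
  "model_obj B p q Mp M f y x = model_con B p Mp f y x + M / fact (q + 1) * Bnorm B (y - x) ^ (q + 1)"
  by (simp add: model_obj_def model_con_def)

lemma model_obj_grad_le:
  assumes "times_cont_diff p f" "lipschitz_deriv B p L f" "p \<ge> 1" "convex_on UNIV f" "real p * L \<le> Mp"
    and "q \<ge> 1" "0 \<le> M"
  shows "model_obj B p q Mp M f y x + grad (\<lambda>y. model_obj B p q Mp M f y x) y (z - y)
    \<le> model_obj B p q Mp M f z x"
proof (rule convex_on_grad_le[of "\<lambda>y. model_obj B p q Mp M f y x"])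
  show "convex_on UNIV (\<lambda>y. model_obj B p q Mp M f y x)"
    unfolding model_obj_altdef
    using assms by (intro convex_on_add convex_on_model_con convex_on_cmul convex_on_Bnorm_power) auto
  show "(\<lambda>y. model_obj B p q Mp M f y x) differentiable (at y)"
    unfolding model_obj_altdef
    using assms(1,3) Bnorm_power_has_derivative[OF assms(6), of x y]
    by (intro differentiable_add differentiable_mult differentiable_const model_con_differentiable)
       (auto simp: differentiable_def)
qed

text \<open>Sufficiency of the KKT conditions: the first-order inequalities of the convex models and
  of \<open>h\<close> are added with weights \<open>u i\<close>, stationarity cancels the linear
  terms, and complementarity removes the constraints at \<open>x'\<close>. The point
  \<open>z\<close> is arbitrary and may violate the model constraints.\<close>

lemma multipliers_lagrangian_le:
  assumes F0: "times_cont_diff p (F 0)" "lipschitz_deriv B p Lp (F 0)" "p \<ge> 1"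
      "convex_on UNIV (F 0)" "real p * Lp \<le> Mp"
    and q: "q \<ge> 1" "0 \<le> M"
    and Fi: "\<And>i. i \<in> {1..m} \<Longrightarrow> times_cont_diff q (F i)"
      "\<And>i. i \<in> {1..m} \<Longrightarrow> lipschitz_deriv B q (Lq i) (F i)"
      "\<And>i. i \<in> {1..m} \<Longrightarrow> convex_on UNIV (F i)"
      "\<And>i. i \<in> {1..m} \<Longrightarrow> real q * Lq i \<le> Mq i"
    and mult: "subproblem_multipliers B m p q Mp M Mq F h x x' u"
  shows "x' \<in> edom h"
    and "ereal (model_obj B p q Mp M (F 0) x' x) + h x'
      \<le> ereal (model_obj B p q Mp M (F 0) z x + (\<Sum>i=1..m. u i * model_con B q (Mq i) (F i) z x)) + h z"
proof -
  let ?o = "\<lambda>y. model_obj B p q Mp M (F 0) y x"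
  let ?c = "\<lambda>i y. model_con B q (Mq i) (F i) y x"
  obtain \<Lambda> where \<Lambda>: "\<Lambda> \<in> subdiff h x'"
      and st: "grad ?o x' + \<Lambda> + (\<Sum>i=1..m. u i *\<^sub>R grad (?c i) x') = 0"
      and u: "\<forall>i\<in>{1..m}. 0 \<le> u i" "\<forall>i\<in>{1..m}. u i * ?c i x' = 0"
    using mult unfolding subproblem_multipliers_def by blast
  show "x' \<in> edom h" using \<Lambda> by (simp add: subdiff_def)
  have h: "h x' + ereal (\<Lambda> (z - x')) \<le> h z" using \<Lambda> by (simp add: subdiff_def)
  have "(grad ?o x' + \<Lambda> + (\<Sum>i=1..m. u i *\<^sub>R grad (?c i) x')) (z - x') = 0"
    by (simp only: st blinfun.zero_left)
  then have st': "grad ?o x' (z - x') + \<Lambda> (z - x') + (\<Sum>i=1..m. u i * grad (?c i) x' (z - x')) = 0"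
    by (simp add: blinfun.add_left blinfun.sum_left blinfun.scaleR_left)
  have o: "?o x' + grad ?o x' (z - x') \<le> ?o z"
    by (rule model_obj_grad_le[OF F0 q])
  have "(\<Sum>i=1..m. u i * grad (?c i) x' (z - x')) \<le> (\<Sum>i=1..m. u i * ?c i z)"
  proof (rule sum_mono)
    fix i assume i: "i \<in> {1..m}"
    have "?c i x' + grad (?c i) x' (z - x') \<le> ?c i z"
      using Fi i q by (intro convex_on_grad_le convex_on_model_con model_con_differentiable) auto
    then have "u i * (?c i x' + grad (?c i) x' (z - x')) \<le> u i * ?c i z"
      using u i by (intro mult_left_mono) auto
    moreover have "u i * ?c i x' = 0" using u i by blast
    ultimately show "u i * grad (?c i) x' (z - x') \<le> u i * ?c i z"
      unfolding distrib_left by linarith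
  qed
  then have "?o x' \<le> ?o z + (\<Sum>i=1..m. u i * ?c i z) + \<Lambda> (z - x')"
    using st' o by linarith
  then have "ereal (?o x') + h x' \<le> ereal (?o z + (\<Sum>i=1..m. u i * ?c i z) + \<Lambda> (z - x')) + h x'"
    by (intro add_right_mono) simp
  also have "\<dots> = ereal (?o z + (\<Sum>i=1..m. u i * ?c i z)) + (h x' + ereal (\<Lambda> (z - x')))"
    by (simp add: ac_simps flip: plus_ereal.simps(1))
  also have "\<dots> \<le> ereal (?o z + (\<Sum>i=1..m. u i * ?c i z)) + h z"
    using h by (rule add_left_mono)
  finally show "ereal (?o x') + h x' \<le> ereal (?o z + (\<Sum>i=1..m. u i * ?c i z)) + h z" .
qed

lemma mta_step_feasible:
  assumes "q \<ge> 1"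
    and Fi: "\<And>i. i \<in> {1..m} \<Longrightarrow> times_cont_diff q (F i)"
      "\<And>i. i \<in> {1..m} \<Longrightarrow> lipschitz_deriv B q (Lq i) (F i)"
      "\<And>i. i \<in> {1..m} \<Longrightarrow> real q * Lq i \<le> Mq i"
    and step: "mta_step B m p q Mp M Mq F h x x'"
  shows "x' \<in> feasible m F"
  unfolding feasible_def
proof (intro CollectI ballI)
  fix i assume i: "i \<in> {1..m}"
  then have "model_con B q (Mq i) (F i) x' x \<le> 0"
    using step by (simp add: mta_step_def is_arg_min_def)
  then show "F i x' \<le> 0"
    using model_con_bounds(1)[OF Fi(1,2)[OF i] assms(1) Fi(3)[OF i], of x' x] by linarith
qed

text \<open>A feasible \<open>z\<close> need not be feasible for the subproblem, but
  \<open>F i z \<le> 0\<close> bounds each constraint model by its error alone. Weighting these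
  errors by \<open>u i\<close>, which is at most \<open>Cu\<close>, yields the second constant of
  the rate.\<close>

lemma multipliers_objective_le:
  assumes F0: "times_cont_diff p (F 0)" "lipschitz_deriv B p Lp (F 0)" "p \<ge> 1"
      "convex_on UNIV (F 0)" "real p * Lp \<le> Mp"
    and q: "q \<ge> 1" "0 \<le> M"
    and Fi: "\<And>i. i \<in> {1..m} \<Longrightarrow> times_cont_diff q (F i)"
      "\<And>i. i \<in> {1..m} \<Longrightarrow> lipschitz_deriv B q (Lq i) (F i)"
      "\<And>i. i \<in> {1..m} \<Longrightarrow> convex_on UNIV (F i)"
      "\<And>i. i \<in> {1..m} \<Longrightarrow> real q * Lq i \<le> Mq i"
    and mult: "subproblem_multipliers B m p q Mp M Mq F h x x' u"
    and Cu: "L2_set u {1..m} \<le> Cu" and z: "z \<in> feasible m F"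
  shows "objective F h x' \<le> objective F h z +
    ereal ((Mp + Lp) / fact (p + 1) * Bnorm B (z - x) ^ (p + 1)
      + (M + (\<Sum>i=1..m. Cu * (Mq i + Lq i))) / fact (q + 1) * Bnorm B (z - x) ^ (q + 1))"
proof -
  let ?o = "\<lambda>y. model_obj B p q Mp M (F 0) y x"
  let ?c = "\<lambda>i y. model_con B q (Mq i) (F i) y x"
  let ?N = "Bnorm B (z - x) ^ (q + 1)"
  note b0 = model_con_bounds[OF F0(1,2,3,5)]
  have "F 0 x' \<le> ?o x'"
    unfolding model_obj_altdef using b0(1)[of x' x] q(2) by (simp add: add_increasing2)
  have oz: "?o z \<le> F 0 z + (Mp + Lp) / fact (p + 1) * Bnorm B (z - x) ^ (p + 1) + M / fact (q + 1) * ?N"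
    unfolding model_obj_altdef using b0(2)[of z x] by simp
  have "(\<Sum>i=1..m. u i * ?c i z) \<le> (\<Sum>i=1..m. Cu * (Mq i + Lq i) / fact (q + 1) * ?N)"
  proof (rule sum_mono)
    fix i assume i: "i \<in> {1..m}"
    note b = model_con_bounds[OF Fi(1,2)[OF i] q(1) Fi(4)[OF i]]
    have u: "0 \<le> u i" "u i \<le> Cu"
      using mult i member_le_L2_set[of "{1..m}" i u] Cu by (auto simp: subproblem_multipliers_def)
    have "F i z \<le> 0" using z i by (simp add: feasible_def)
    then have "?c i z \<le> (Mq i + Lq i) / fact (q + 1) * ?N" using b(2)[of z x] by linarith
    then have "u i * ?c i z \<le> u i * ((Mq i + Lq i) / fact (q + 1) * ?N)"
      using u by (intro mult_left_mono)
    also have "\<dots> \<le> Cu * ((Mq i + Lq i) / fact (q + 1) * ?N)"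
      using u b(3) by (intro mult_right_mono mult_nonneg_nonneg divide_nonneg_nonneg) auto
    finally show "u i * ?c i z \<le> Cu * (Mq i + Lq i) / fact (q + 1) * ?N" by simp
  qed
  also have "\<dots> = (\<Sum>i=1..m. Cu * (Mq i + Lq i)) / fact (q + 1) * ?N"
    by (simp only: sum_distrib_right sum_divide_distrib)
  finally have "?o z + (\<Sum>i=1..m. u i * ?c i z) \<le> F 0 z + ((Mp + Lp) / fact (p + 1) * Bnorm B (z - x) ^ (p + 1)
      + (M + (\<Sum>i=1..m. Cu * (Mq i + Lq i))) / fact (q + 1) * ?N)" (is "_ \<le> _ + ?E")
    using oz by (simp add: add_divide_distrib distrib_right)
  note le = this
  have "objective F h x' \<le> ereal (?o x') + h x'"
    unfolding objective_def using \<open>F 0 x' \<le> ?o x'\<close> by (intro add_right_mono) simp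
  also have "\<dots> \<le> ereal (?o z + (\<Sum>i=1..m. u i * ?c i z)) + h z"
    by (rule multipliers_lagrangian_le(2)[OF F0 q Fi mult])
  also have "\<dots> \<le> ereal (F 0 z + ?E) + h z"
    using le by (intro add_right_mono) simp
  also have "\<dots> = objective F h z + ereal ?E"
    by (simp add: objective_def ac_simps flip: plus_ereal.simps(1))
  finally show ?thesis .
qed

end

text \<open>Multiplied by \<open>(k + 1) \<cdots> (k + r)\<close>, the recursion has the invariant bound \<open>C (r + 1)\<^sup>r\<^sup>+\<^sup>1\<close>.\<close>
lemma sublinear_rate:
  fixes \<delta> :: "nat \<Rightarrow> real"
  assumes C: "0 \<le> C" and base: "\<delta> 1 \<le> C"
    and step: "\<And>k \<alpha>. k \<ge> 1 \<Longrightarrow> \<alpha> = real (r + 1) / real (k + r + 1) \<Longrightarrow>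
        \<delta> (Suc k) \<le> (1 - \<alpha>) * \<delta> k + C * \<alpha> ^ (r + 1)"
    and k: "k \<ge> 1"
  shows "\<delta> k \<le> C * real (r + 1) ^ (r + 1) / real k ^ r"
proof -
  define K where "K = C * real (r + 1) ^ (r + 1)"
  define P where "P k = pochhammer (real k + 1) r" for k
  have "0 \<le> K" using C by (simp add: K_def)
  have P_ge: "real k ^ r \<le> P k" for k
  proof -
    have "(\<Prod>i=0..<r. real k) \<le> (\<Prod>i=0..<r. real k + 1 + real i)" by (intro prod_mono) auto
    then show ?thesis by (simp add: P_def pochhammer_prod)
  qed
  have P_le: "P k \<le> real (k + r) ^ r" for k
  proof -
    have "(\<Prod>i=0..<r. real k + 1 + real i) \<le> (\<Prod>i=0..<r. real (k + r))" by (intro prod_mono) auto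
    then show ?thesis by (simp add: P_def pochhammer_prod)
  qed
  \<comment> \<open>This identity turns the contraction factor \<open>k / (k + r + 1)\<close> into
    \<open>k / (k + 1)\<close> after multiplication by \<open>P\<close>.\<close>
  have P_Suc: "P (Suc k) * real (k + 1) = P k * real (k + r + 1)" for k
    using pochhammer_rec[of "real k + 1" r] pochhammer_rec'[of "real k + 1" r]
    by (simp add: P_def algebra_simps)
  have "\<delta> k * P k \<le> K" using k
  proof (induction k rule: dec_induct)
    case base
    have "\<delta> 1 * P 1 \<le> C * P 1" using assms(2) P_ge[of 1] by (intro mult_right_mono) auto
    also have "\<dots> \<le> C * real (r + 1) ^ r" using P_le[of 1] C by (intro mult_left_mono) auto
    also have "\<dots> \<le> K" unfolding K_def using C by (intro mult_left_mono power_increasing) auto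
    finally show ?case .
  next
    case (step k)
    define s where "s = real (k + r + 1)"
    define \<alpha> where "\<alpha> = real (r + 1) / s"
    have s: "0 < s" "real (k + 1) \<le> s" by (auto simp: s_def)
    have a: "1 - \<alpha> = real k / s" using s by (simp add: \<alpha>_def s_def field_simps)
    have P0: "0 \<le> P (Suc k)" using P_ge[of "Suc k"] by (rule order_trans[rotated]) simp
    have "\<delta> (Suc k) * P (Suc k) \<le> ((1 - \<alpha>) * \<delta> k + C * \<alpha> ^ (r + 1)) * P (Suc k)"
      using assms(3)[OF step(1)] P0 by (intro mult_right_mono) (auto simp: \<alpha>_def s_def)
    also have "\<dots> = real k / s * P (Suc k) * \<delta> k + K * (P (Suc k) / s ^ (r + 1))"
    proof -
      have "C * \<alpha> ^ (r + 1) = K / s ^ (r + 1)" unfolding \<alpha>_def K_def power_divide by simp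
      then show ?thesis unfolding a by (simp only: distrib_right) simp
    qed
    also have "real k / s * P (Suc k) = real k / real (k + 1) * P k"
      using P_Suc[of k] s by (simp add: s_def field_simps)
    \<comment> \<open>The inhomogeneous term becomes at most \<open>K / (k + 1)\<close>, exactly
      what the contraction of the bound \<open>K\<close> leaves free.\<close>
    also have "P (Suc k) / s ^ (r + 1) \<le> s ^ r / s ^ (r + 1)"
      using P_le[of "Suc k"] s by (intro divide_right_mono) (auto simp: s_def algebra_simps)
    also have "s ^ r / s ^ (r + 1) = 1 / s" using s by simp
    also have "1 / s \<le> 1 / real (k + 1)" using s by (intro divide_left_mono) auto
    also have "real k / real (k + 1) * P k * \<delta> k + K * (1 / real (k + 1))
       = real k / real (k + 1) * (\<delta> k * P k) + K * (1 / real (k + 1))" by simp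
    also have "\<dots> \<le> real k / real (k + 1) * K + K * (1 / real (k + 1))"
      using step.IH by (intro add_right_mono mult_left_mono) auto
    also have "real k / real (k + 1) = 1 - 1 / real (k + 1)" by (simp add: field_simps)
    also have "(1 - 1 / real (k + 1)) * K + K * (1 / real (k + 1)) = K"
      by (simp only: left_diff_distrib) simp
    finally show ?case using \<open>0 \<le> K\<close> by (simp add: mult_left_mono)
  qed
  have "0 < real k ^ r" using k by simp
  then have "0 < P k" using P_ge[of k] by linarith
  then have "\<delta> k \<le> K / P k" using \<open>\<delta> k * P k \<le> K\<close> by (simp add: field_simps)
  also have "\<dots> \<le> K / real k ^ r"
    using P_ge[of k] \<open>0 < real k ^ r\<close> \<open>0 \<le> K\<close> \<open>0 < P k\<close> by (intro divide_left_mono) auto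
  finally show ?thesis by (simp add: K_def)
qed

section \<open>Convergence rate along the iterates\<close>

context energy_norm begin

text \<open>The radius \<open>R\<close> is a parameter because the lemma is used twice: with an
  arbitrary comparator, and with an iterate as comparator.\<close>

lemma comparator_rate:
  fixes x :: "nat \<Rightarrow> 'a" and ob :: "'a \<Rightarrow> real"
  assumes conv: "convex_on S ob" and xS: "\<And>k. k \<ge> 1 \<Longrightarrow> x k \<in> S"
    and step: "\<And>k z. z \<in> S \<Longrightarrow>
      ob (x (Suc k)) \<le> ob z + (D1 * Bnorm B (z - x k) ^ (p + 1) + D2 * Bnorm B (z - x k) ^ (q + 1))"
    and D: "0 \<le> D1" "0 \<le> D2" and r: "r \<le> p" "r \<le> q"
    and y: "y \<in> S" and R: "\<And>k. Bnorm B (y - x k) \<le> R" and k: "k \<ge> 1"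
  shows "ob (x k) \<le> ob y + (D1 * R ^ (p + 1) + D2 * R ^ (q + 1)) * real (r + 1) ^ (r + 1) / real k ^ r"
proof -
  have "0 \<le> R" using R[of 0] Bnorm_nonneg[of "y - x 0"] by linarith
  have "ob (x k) - ob y \<le> (D1 * R ^ (p + 1) + D2 * R ^ (q + 1)) * real (r + 1) ^ (r + 1) / real k ^ r"
  proof (rule sublinear_rate[where \<delta> = "\<lambda>k. ob (x k) - ob y", OF _ _ _ k])
    show "0 \<le> D1 * R ^ (p + 1) + D2 * R ^ (q + 1)" using D \<open>0 \<le> R\<close> by simp
    have "D1 * Bnorm B (y - x 0) ^ (p + 1) + D2 * Bnorm B (y - x 0) ^ (q + 1)
        \<le> D1 * R ^ (p + 1) + D2 * R ^ (q + 1)"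
      using D R by (intro add_mono mult_left_mono power_mono) auto
    \<comment> \<open>The first step compares with \<open>y\<close> itself, so \<open>x 0\<close>
      need not lie in \<open>S\<close>.\<close>
    then show "ob (x 1) - ob y \<le> D1 * R ^ (p + 1) + D2 * R ^ (q + 1)"
      using step[OF y, of 0] by simp
    fix k \<alpha> assume k: "k \<ge> 1" and \<alpha>: "\<alpha> = real (r + 1) / real (k + r + 1)"
    have a: "0 \<le> \<alpha>" "\<alpha> \<le> 1" by (auto simp: \<alpha> field_simps)
    define z where "z = (1 - \<alpha>) *\<^sub>R x k + \<alpha> *\<^sub>R y"
    have z: "z \<in> S" "ob z \<le> (1 - \<alpha>) * ob (x k) + \<alpha> * ob y"
      unfolding z_def using convexD_alt[OF convex_on_imp_convex[OF conv] xS[OF k] y a]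
        convex_onD[OF conv a xS[OF k] y] by auto
    have "z - x k = \<alpha> *\<^sub>R (y - x k)" by (simp add: z_def algebra_simps)
    then have "Bnorm B (z - x k) \<le> \<alpha> * R"
      using a R[of k] by (simp add: Bnorm_scaleR mult_left_mono)
    \<comment> \<open>As \<open>\<alpha> \<le> 1\<close>, both powers of \<open>\<alpha>\<close> are
      dominated by the common exponent \<open>r + 1\<close>.\<close>
    have N: "Bnorm B (z - x k) ^ (n + 1) \<le> \<alpha> ^ (r + 1) * R ^ (n + 1)" if "r \<le> n" for n
    proof -
      have "Bnorm B (z - x k) ^ (n + 1) \<le> \<alpha> ^ (n + 1) * R ^ (n + 1)"
        using power_mono[OF \<open>Bnorm B (z - x k) \<le> \<alpha> * R\<close> Bnorm_nonneg] by (simp only: power_mult_distrib)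
      also have "\<dots> \<le> \<alpha> ^ (r + 1) * R ^ (n + 1)"
        using that a \<open>0 \<le> R\<close> by (intro mult_right_mono power_decreasing) auto
      finally show ?thesis .
    qed
    have "D1 * Bnorm B (z - x k) ^ (p + 1) \<le> D1 * (\<alpha> ^ (r + 1) * R ^ (p + 1))"
      by (rule mult_left_mono[OF N[OF r(1)] D(1)])
    moreover have "D2 * Bnorm B (z - x k) ^ (q + 1) \<le> D2 * (\<alpha> ^ (r + 1) * R ^ (q + 1))"
      by (rule mult_left_mono[OF N[OF r(2)] D(2)])
    ultimately have "ob (x (Suc k)) \<le> (1 - \<alpha>) * ob (x k) + \<alpha> * ob y
        + (D1 * (\<alpha> ^ (r + 1) * R ^ (p + 1)) + D2 * (\<alpha> ^ (r + 1) * R ^ (q + 1)))"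
      using step[OF z(1), of k] z(2) by linarith
    then show "ob (x (Suc k)) - ob y \<le> (1 - \<alpha>) * (ob (x k) - ob y)
        + (D1 * R ^ (p + 1) + D2 * R ^ (q + 1)) * \<alpha> ^ (r + 1)"
      by (simp add: algebra_simps)
  qed
  then show ?thesis by simp
qed

text \<open>An optimal point need not exist or lie in the ball of radius \<open>D\<close>, so it is replaced by late
  iterates: comparison with an arbitrary \<open>y\<close> shows that they are asymptotically as good as \<open>y\<close>,
  and they are within \<open>2 D\<close> of every iterate.\<close>
lemma iterates_rate:
  fixes x :: "nat \<Rightarrow> 'a" and ob :: "'a \<Rightarrow> real"
  assumes conv: "convex_on S ob" and xS: "\<And>k. k \<ge> 1 \<Longrightarrow> x k \<in> S"
    and step: "\<And>k z. z \<in> S \<Longrightarrow>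
      ob (x (Suc k)) \<le> ob z + (D1 * Bnorm B (z - x k) ^ (p + 1) + D2 * Bnorm B (z - x k) ^ (q + 1))"
    and D12: "0 \<le> D1" "0 \<le> D2" and r: "r \<le> p" "r \<le> q" "1 \<le> r"
    and D: "\<And>k. Bnorm B (x k) \<le> D"
    and y: "y \<in> S" and k: "k \<ge> 1"
  shows "ob (x k) \<le> ob y
    + (D1 * (2 * D) ^ (p + 1) + D2 * (2 * D) ^ (q + 1)) * real (r + 1) ^ (r + 1) / real k ^ r"
    (is "_ \<le> _ + ?C")
proof -
  define R where "R = 2 * max D (Bnorm B y)"
  define K where "K = (D1 * R ^ (p + 1) + D2 * R ^ (q + 1)) * real (r + 1) ^ (r + 1)"
  have Ry: "Bnorm B (y - x k) \<le> R" for k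
    unfolding R_def using D[of k] by (intro Bnorm_diff_le) auto
  have 1: "ob (x j) \<le> ob y + K / real j ^ r" if "j \<ge> 1" for j
    unfolding K_def by (rule comparator_rate[where x = x and ob = ob, OF conv xS step D12 r(1,2) y Ry that])
  have 2: "ob (x k) \<le> ob (x j) + ?C" if "j \<ge> 1" for j
    by (rule comparator_rate[where x = x and ob = ob, OF conv xS step D12 r(1,2) xS[OF that] Bnorm_diff_le[OF D D] k])
  have "(\<lambda>j. K / real j ^ r) \<longlonglongrightarrow> 0"
    using r(3) by (intro tendsto_divide_0[OF tendsto_const] filterlim_at_top_imp_at_infinity
      filterlim_pow_at_top filterlim_real_sequentially) auto
  then have "(\<lambda>j. ob y + K / real j ^ r + ?C) \<longlonglongrightarrow> ob y + 0 + ?C"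
    by (intro tendsto_intros)
  moreover have "ob (x k) \<le> ob y + K / real j ^ r + ?C" if "j \<ge> 1" for j
    using 1[OF that] 2[OF that] by linarith
  \<comment> \<open>Letting \<open>j\<close> tend to infinity removes the only term that depends on
    the distance to \<open>y\<close>.\<close>
  ultimately have "ob (x k) \<le> ob y + 0 + ?C" by (intro LIMSEQ_le_const) auto
  then show ?thesis by simp
qed

end

section \<open>From extended-valued to real-valued functions, and the final estimate\<close>

lemma objective_eq_ereal:
  assumes "proper_fun h" "y \<in> edom h"
  shows "objective F h y = ereal (F 0 y + real_of_ereal (h y))"
proof -
  have "\<bar>h y\<bar> \<noteq> \<infinity>" using assms by (auto simp: proper_fun_def edom_def)
  then have "h y = ereal (real_of_ereal (h y))" by (simp add: ereal_real)
  then show ?thesis unfolding objective_def by (metis plus_ereal.simps(1))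
qed

lemma convex_on_edom:
  assumes h: "proper_fun h" "convex_fun h"
  shows "convex_on (edom h) (\<lambda>y. real_of_ereal (h y))"
proof -
  have e: "h y = ereal (real_of_ereal (h y))" if "y \<in> edom h" for y
    using that h(1) by (auto simp: proper_fun_def edom_def ereal_real)
  have le: "h ((1 - t) *\<^sub>R a + t *\<^sub>R b)
      \<le> ereal ((1 - t) * real_of_ereal (h a) + t * real_of_ereal (h b))"
    if "0 < t" "t < 1" "a \<in> edom h" "b \<in> edom h" for t a b
  proof -
    have "h ((1 - t) *\<^sub>R a + t *\<^sub>R b) \<le> ereal (1 - t) * h a + ereal t * h b"
      using h(2) that by (simp add: convex_fun_def)
    also have "\<dots> = ereal ((1 - t) * real_of_ereal (h a) + t * real_of_ereal (h b))"
      by (subst e[OF that(3)], subst e[OF that(4)]) simp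
    finally show ?thesis .
  qed
  have mem: "(1 - t) *\<^sub>R a + t *\<^sub>R b \<in> edom h"
    if "0 < t" "t < 1" "a \<in> edom h" "b \<in> edom h" for t a b
    using le[OF that] by (auto simp: edom_def)
  show ?thesis
  proof (rule convex_onI)
    fix t a b assume t: "0 < t" "t < (1::real)" "a \<in> edom h" "b \<in> edom h"
    show "real_of_ereal (h ((1 - t) *\<^sub>R a + t *\<^sub>R b))
        \<le> (1 - t) * real_of_ereal (h a) + t * real_of_ereal (h b)"
      using le[OF t] e[OF mem[OF t]] by (metis ereal_less_eq(3))
  next
    show "convex (edom h)"
      unfolding convex_alt
    proof (intro ballI allI impI)
      fix a b t assume ab: "a \<in> edom h" "b \<in> edom h" and "0 \<le> t \<and> t \<le> (1::real)"
      then consider "t = 0" | "t = 1" | "0 < t" "t < 1" by linarith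
      then show "(1 - t) *\<^sub>R a + t *\<^sub>R b \<in> edom h" by cases (use ab mem in auto)
    qed
  qed
qed

lemma convex_feasible:
  assumes "\<And>i. i \<in> {1..m} \<Longrightarrow> convex_on UNIV (F i)"
  shows "convex (feasible m F)"
proof -
  have "feasible m F = (\<Inter>i\<in>{1..m}. {y. F i y \<le> 0})" by (auto simp: feasible_def)
  moreover have "convex {y. F i y \<le> 0}" if "i \<in> {1..m}" for i
    unfolding convex_alt
  proof (intro ballI allI impI CollectI)
    fix a b t assume ab: "a \<in> {y. F i y \<le> 0}" "b \<in> {y. F i y \<le> 0}" and t: "0 \<le> t \<and> t \<le> (1::real)"
    have "F i ((1 - t) *\<^sub>R a + t *\<^sub>R b) \<le> (1 - t) * F i a + t * F i b"
      using convex_onD[OF assms[OF that], of t a b] t by simp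
    also have "\<dots> \<le> 0" using ab t by (intro add_nonpos_nonpos mult_nonneg_nonpos) auto
    finally show "F i ((1 - t) *\<^sub>R a + t *\<^sub>R b) \<le> 0" .
  qed
  ultimately show ?thesis by (auto intro!: convex_INT)
qed

theorem theorem5p1:
  fixes B :: "'a::euclidean_space \<Rightarrow> 'a \<Rightarrow>\<^sub>L real"
    and F :: "nat \<Rightarrow> 'a \<Rightarrow> real" and h :: "'a \<Rightarrow> ereal"
    and x :: "nat \<Rightarrow> 'a" and u :: "nat \<Rightarrow> nat \<Rightarrow> real"
    and m p q :: nat
    and Lp Mp M Cu D D1 D2 :: real and Lq Mq :: "nat \<Rightarrow> real"
  assumes "self_adjoint_pos_def B"
    and "p \<ge> 1" and "q \<ge> 1"
    \<comment> \<open>Assumption 1\<close>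
    and "times_cont_diff p (F 0)" and "lipschitz_deriv B p Lp (F 0)"
    and "\<And>i. i \<in> {1..m} \<Longrightarrow> times_cont_diff q (F i)"
    and "\<And>i. i \<in> {1..m} \<Longrightarrow> lipschitz_deriv B q (Lq i) (F i)"
    and "proper_fun h" and "convex_fun h" and "locally_lipschitz_fun B h"
    \<comment> \<open>Assumption 2\<close>
    and "feasible m F \<noteq> {}"
    and "\<And>z. z \<in> feasible m F \<Longrightarrow>
           bounded {y \<in> feasible m F. objective F h y \<le> objective F h z}"
    \<comment> \<open>Assumption 3\<close>
    and "mfcq m F"
    and "\<And>i. i \<in> {0..m} \<Longrightarrow> convex_on UNIV (F i)"
    and "Mp \<ge> real p * Lp" and "M > 0"
    and "\<And>i. i \<in> {1..m} \<Longrightarrow> Mq i \<ge> real q * Lq i"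
    \<comment> \<open>the algorithm\<close>
    and "x 0 \<in> feasible m F"
    and "\<And>k. mta_step B m p q Mp M Mq F h (x k) (x (Suc k))"
    \<comment> \<open>multipliers and constants\<close>
    and "\<And>k. subproblem_multipliers B m p q Mp M Mq F h (x k) (x (Suc k)) (u (Suc k))"
    and "Cu > 0" and "\<And>k. k \<ge> 1 \<Longrightarrow> L2_set (u k) {1..m} \<le> Cu"
    and "D > 0" and "\<And>k. Bnorm B (x k) \<le> D"
    and "D1 = (Mp + Lp) / fact (p + 1)"
    and "D2 = (M + (\<Sum>i=1..m. Cu * (Mq i + Lq i))) / fact (q + 1)"
  shows "\<forall>k\<ge>1. objective F h (x k) - optimal_value m F h \<le>
           ereal (2 * max (real (p + 1) ^ (p + 1)) (real (q + 1) ^ (q + 1))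
                    * (D1 * (2 * D) ^ (p + 1) + D2 * (2 * D) ^ (q + 1))
                    / real k ^ min p q)"
proof (intro allI impI)
  fix k :: nat assume k: "k \<ge> 1"
  interpret energy_norm B by unfold_locales (fact assms(1))
  define ob where "ob y = F 0 y + real_of_ereal (h y)" for y
  \<comment> \<open>On \<open>S\<close> the objective is finite, so the real-valued rate lemmas
    apply; all iterates from index 1 on lie in it.\<close>
  define S where "S = feasible m F \<inter> edom h"
  define r where "r = min p q"
  define C where "C = D1 * (2 * D) ^ (p + 1) + D2 * (2 * D) ^ (q + 1)"
  have F0: "convex_on UNIV (F 0)" using assms(14) by simp
  have Fi: "convex_on UNIV (F i)" if "i \<in> {1..m}" for i using assms(14)[of i] that by simp
  note data = assms(4,5,2) F0 assms(15,3) less_imp_le[OF assms(16)] assms(6,7) Fi assms(17)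
  have ob: "objective F h y = ereal (ob y)" if "y \<in> edom h" for y
    unfolding ob_def by (rule objective_eq_ereal[OF assms(8) that])
  have xS: "x k \<in> S" if k: "k \<ge> 1" for k
  proof -
    obtain j where j: "k = Suc j" using k by (cases k) auto
    have "x (Suc j) \<in> feasible m F"
      by (rule mta_step_feasible[OF assms(3,6,7,17,19)])
    moreover have "x (Suc j) \<in> edom h"
      by (rule multipliers_lagrangian_le(1)[OF data assms(20)])
    ultimately show ?thesis by (simp add: S_def j)
  qed
  have "convex_on (edom h) ob" unfolding ob_def
    by (intro convex_on_add convex_on_edom assms(8,9) convex_on_subset[OF F0]
        convex_on_imp_convex[OF convex_on_edom[OF assms(8,9)]]) auto
  then have conv: "convex_on S ob" unfolding S_def
    by (rule convex_on_subset)
       (auto intro: convex_Int convex_feasible Fi convex_on_imp_convex[OF convex_on_edom[OF assms(8,9)]])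
  have step: "ob (x (Suc k)) \<le> ob z + (D1 * Bnorm B (z - x k) ^ (p + 1) + D2 * Bnorm B (z - x k) ^ (q + 1))"
    if z: "z \<in> S" for k z
  proof -
    have "objective F h (x (Suc k)) \<le> objective F h z +
        ereal (D1 * Bnorm B (z - x k) ^ (p + 1) + D2 * Bnorm B (z - x k) ^ (q + 1))"
      unfolding assms(25,26)
      by (rule multipliers_objective_le[OF data assms(20) assms(22)]) (use z in \<open>auto simp: S_def\<close>)
    then show ?thesis using z xS[of "Suc k"] by (simp add: S_def ob)
  qed
  have D1: "0 \<le> D1" unfolding assms(25)
    using model_con_bounds(3)[OF assms(4,5,2,15)] by simp
  have D2: "0 \<le> D2" unfolding assms(26)
    using model_con_bounds(3)[OF assms(6,7,3,17)] assms(16,21)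
    by (intro divide_nonneg_nonneg add_nonneg_nonneg[of M] sum_nonneg mult_nonneg_nonneg[of Cu]) auto
  have "0 \<le> C" unfolding C_def using D1 D2 assms(23) by simp
  have r: "r \<le> p" "r \<le> q" "1 \<le> r" using assms(2,3) by (auto simp: r_def)
  let ?M = "max (real (p + 1) ^ (p + 1)) (real (q + 1) ^ (q + 1))"
  let ?E = "2 * ?M * C / real k ^ r"
  have le: "ob (x k) \<le> ob y + ?E" if "y \<in> S" for y
  proof -
    have "ob (x k) \<le> ob y + C * real (r + 1) ^ (r + 1) / real k ^ r"
      unfolding C_def by (rule iterates_rate[where x = x and ob = ob, OF conv xS step D1 D2 r assms(24) that k])
    \<comment> \<open>As \<open>r\<close> is \<open>p\<close> or \<open>q\<close>, the constant is
      one of the two entries of the maximum; the factor 2 in the claimed bound is slack.\<close>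
    also have "real (r + 1) ^ (r + 1) \<le> ?M" by (auto simp: r_def min_def)
    also have "C * ?M \<le> 2 * ?M * C" using \<open>0 \<le> C\<close> by (simp add: mult_nonneg_nonneg le_max_iff_disj)
    finally show ?thesis
      using \<open>0 \<le> C\<close> by (auto simp: divide_right_mono mult_left_mono)
  qed
  have "objective F h (x k) - ereal ?E \<le> objective F h y" if "y \<in> feasible m F" for y
  proof (cases "y \<in> edom h")
    case True
    then show ?thesis using le[of y] that ob xS[OF k] by (simp add: S_def)
  next
    case False
    then show ?thesis by (simp add: objective_def edom_def)
  qed
  then have "objective F h (x k) - ereal ?E \<le> optimal_value m F h"
    unfolding optimal_value_def by (intro INF_greatest)
  then show "objective F h (x k) - optimal_value m F h \<le> ereal (2 * ?M * (D1 * (2 * D) ^ (p + 1) + D2 * (2 * D) ^ (q + 1)) / real k ^ min p q)"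
    unfolding C_def[symmetric] r_def[symmetric]
    \<comment> \<open>A finite value only needs rearranging. The value minus infinity contradicts
      the finite lower bound, and plus infinity makes the difference minus infinity.\<close>
    using ob xS[OF k] by (cases "optimal_value m F h") (auto simp: S_def)
qed

end
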